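(* Consider the IMEX Runge-Kutta scheme for the Boltzmann equation $$F^{(i)} = f^{n}+\Delta t \sum_{j=1}^{i-1} \widetilde{a}_{ij} \Big(\frac{\mu}{\varepsilon}\, g(F^{(j)})-v\cdot\nabla_x F^{(j)}\Big)+\Delta t\sum_{j=1}^{i} a_{ij}\frac{\mu}{\varepsilon}\big(M[F^{(j)}]-F^{(j)}\big),\qquad i=1,\dots,\nu,$$ $$f^{n+1} = f^{n}+\Delta t\sum_{i=1}^{\nu}\widetilde{w}_{i}\Big(\frac{\mu}{\varepsilon} g(F^{(i)})-v\cdot\nabla_x F^{(i)}\Big)+\Delta t\sum_{i=1}^{\nu}w_{i}\frac{\mu}{\varepsilon}\big(M[F^{(i)}]-F^{(i)}\big).$$ If $\det A\neq 0$ and the scheme is globally stiffly accurate, i.e. $w_i=a_{\nu i}$ and $\widetilde w_i=\widetilde a_{\nu i}$ for all $i=1,\dots,\nu$, then in the limit $\varepsilon\to 0$ the scheme becomes the explicit Runge-Kutta scheme characterized by $(\widetilde A,\widetilde w,\widetilde c)$ applied to the compressible Euler system $\partial_t u+\nabla_x\cdot \mathcal F(u)=0$. That is, in the limit the moment vectors $U^{(i)}=\int_{\mathbb R^3}F^{(i)}\phi\,dv$, $u^n=\int_{\mathbb R^3} f^n\phi\,dv$ and $u^{n+1}=\int_{\mathbb R^3} f^{n+1}\phi\,dv$, where $\phi(v)=(1,v,|v|^2/2)^T$, satisfy $$U^{(i)}=u^n-\Delta t\sum_{j=1}^{i-1}\widetilde a_{ij}\,\nabla_x\cdot \mathcal F(U^{(j)}),\quad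 i=1,\dots,\nu,\qquad u^{n+1}=u^n-\Delta t\sum_{i=1}^{\nu}\widetilde w_i\,\nabla_x\cdot \mathcal F(U^{(i)}).$$
   Context: The Boltzmann equation is $\partial_t f+v\cdot\nabla_x f=\frac1\varepsilon Q_B(f,f)$ for a nonnegative $f(x,v,t)$, $v\in\mathbb R^3$, $x\in\Omega\subset\mathbb R^{d_x}$, $t>0$, with Knudsen number $\varepsilon>0$ and $$Q_B(f,f)(v)=\int_{\mathbb R^3\times S^2}B(|v-v_*|,n)\,[f(v')f(v'_* )-f(v)f(v_* )]\,dv_*\,dn,$$ $$v'=v-\tfrac12(v-v_* )+\tfrac12|v-v_*|n,\qquad v'_*=v-\tfrac12(v-v_* )+(v_*-v)\cdot 0+\big[(v-v_* )\cdot 0\big]-\tfrac12|v-v_*|n,$$ that is, $v'=\frac{v+v_*}{2}+\frac12|v-v_*|n$ and $v'_*=\frac{v+v_*}{2}-\frac12|v-v_*|n$, where $B\ge 0$ is a collision kernel. Moments: $(\rho,\rho w,E)^T=\int_{\mathbb R^3} f\,(1,v,|v|^2/2)^T dv$ and $T=\frac1{3\rho}(2E-\rho|w|^2)$ (here $w$ without index denotes the mean velocity; $w_i$ denote Runge-Kutta weights). Local Maxwellian: $M[f]=\frac{\rho}{(2\pi T)^{3/2}}\exp\big(-\frac{|w-v|^2}{2T}\big)$, with the moments of $f$. Decomposition: $\mu>0$ is a constant such that $P(f,f):=Q_B(f,f)+\mu f\ge0$, and $g(f):=P(f,f)/\mu-M[f]$, so that $Q_B(f,f)=\mu g(f)+\mu(M[f]-f)$.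 Since $Q_B$ conserves mass, momentum and energy, $\frac1\mu\int_{\mathbb R^3} P(f,f)\phi\,dv=\int_{\mathbb R^3} f\phi\,dv$. Euler system: $u=(\rho,\rho w,E)^T$, $\mathcal F(u)=(\rho w,\ \rho w\otimes w+pI,\ Ew+pw)^T$, $p=\rho T$, $I$ the identity matrix. Runge-Kutta coefficients: $\widetilde A=(\widetilde a_{ij})$ is a real $\nu\times\nu$ matrix with $\widetilde a_{ij}=0$ for $j\ge i$, $\widetilde c_i=\sum_{j=1}^{i-1}\widetilde a_{ij}$, $\widetilde w=(\widetilde w_1,\dots,\widetilde w_\nu)^T$; $A=(a_{ij})$ is a real $\nu\times\nu$ matrix with $a_{ij}=0$ for $j>i$, $c_i=\sum_{j=1}^{\nu}a_{ij}$, $w=(w_1,\dots,w_\nu)^T$. $\Delta t>0$ is the time step. The limit $\varepsilon\to0$ is understood formally: $f^n$ and $\Delta t$ are fixed, and the ($\varepsilon$-dependent) stages $F^{(i)}$ are smooth, have positive density and temperature, and converge as $\varepsilon\to0$ in a sense strong enough that one may pass to the limit in $M[F^{(i)}]$, $g(F^{(i)})$, $v\cdot\nabla_xF^{(i)}$ and in the moments of these quantities. *)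

theory Defs
  imports "HOL-Analysis.Analysis"
begin

text \<open>A velocity distribution is a function on velocity space. The macroscopic state is the triple
  (mass density, momentum density, energy density).\<close>

type_synonym vdist = "real^3 \<Rightarrow> real"
type_synonym state = "real \<times> (real^3) \<times> real"

definition invariants :: "real^3 \<Rightarrow> state" where
  "invariants v = (1, v, (norm v)\<^sup>2 / 2)"

definition finite_moments :: "vdist \<Rightarrow> bool" where
  "finite_moments f \<longleftrightarrow> integrable lborel (\<lambda>v. f v *\<^sub>R invariants v)"

definition moments :: "vdist \<Rightarrow> state" where
  "moments f = (\<integral>v. f v *\<^sub>R invariants v \<partial>lborel)"

definition mass_density :: "state \<Rightarrow> real" where
  "mass_density u = fst u"

definition mean_velocity :: "state \<Rightarrow> real^3" where
  "mean_velocity u = fst (snd u) /\<^sub>R mass_density u"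

definition energy :: "state \<Rightarrow> real" where
  "energy u = snd (snd u)"

definition temperature :: "state \<Rightarrow> real" where
  "temperature u = (2 * energy u - mass_density u * (norm (mean_velocity u))\<^sup>2) / (3 * mass_density u)"

definition pressure :: "state \<Rightarrow> real" where
  "pressure u = mass_density u * temperature u"

definition maxwellian :: "vdist \<Rightarrow> vdist" where
  "maxwellian f v =
     (let u = moments f in
       mass_density u / (2 * pi * temperature u) powr (3/2)
         * exp (- (norm (mean_velocity u - v))\<^sup>2 / (2 * temperature u)))"

text \<open>The surface measure of the unit sphere of dimension two, as a measure on the ambient space.
  It is the cone measure: a set of directions is assigned three times the volume of
  the part of the unit ball lying over it, so that the total mass is \<open>4 * pi\<close>.\<close>

definition sphere_measure :: "(real^3) measure" where
  "sphere_measure =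
     distr (density lborel (\<lambda>x. 3 * indicator (cball 0 1) x))
       borel (\<lambda>x. x /\<^sub>R norm x)"

definition post_v :: "real^3 \<Rightarrow> real^3 \<Rightarrow> real^3 \<Rightarrow> real^3" where
  "post_v v vs n = (v + vs) /\<^sub>R 2 + (norm (v - vs) / 2) *\<^sub>R n"

definition post_vs :: "real^3 \<Rightarrow> real^3 \<Rightarrow> real^3 \<Rightarrow> real^3" where
  "post_vs v vs n = (v + vs) /\<^sub>R 2 - (norm (v - vs) / 2) *\<^sub>R n"

definition Q_B :: "(real \<Rightarrow> real^3 \<Rightarrow> real) \<Rightarrow> vdist \<Rightarrow> vdist" where
  "Q_B B f v =
     (\<integral>(vs, n). B (norm (v - vs)) n
        * (f (post_v v vs n) * f (post_vs v vs n) - f v * f vs) \<partial>(lborel \<Otimes>\<^sub>M sphere_measure))"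

text \<open>Conservation of mass, momentum and energy. For a kernel depending on an arbitrary direction
  \<open>n\<close> of the sphere this is a genuine condition: it does not follow from nonnegativity of \<open>B\<close>.\<close>

definition conserves_invariants :: "(real \<Rightarrow> real^3 \<Rightarrow> real) \<Rightarrow> vdist \<Rightarrow> bool" where
  "conserves_invariants B f \<longleftrightarrow> finite_moments (Q_B B f) \<and> moments (Q_B B f) = 0"

definition P_B :: "(real \<Rightarrow> real^3 \<Rightarrow> real) \<Rightarrow> real \<Rightarrow> vdist \<Rightarrow> vdist" where
  "P_B B \<mu> f v = Q_B B f v + \<mu> * f v"

definition g_B :: "(real \<Rightarrow> real^3 \<Rightarrow> real) \<Rightarrow> real \<Rightarrow> vdist \<Rightarrow> vdist" where
  "g_B B \<mu> f v = P_B B \<mu> f v / \<mu> - maxwellian f v"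

text \<open>Space has dimension \<open>CARD('d)\<close>, and the injection \<open>\<iota>\<close> tells which of the three velocity
  components transports in which coordinate direction; in particular \<open>CARD('d) \<le> 3\<close>.
  The usual convention for dimension at most three is that \<open>\<iota>\<close> is the inclusion of the first indices.\<close>

definition partial :: "'d \<Rightarrow> (real^'d \<Rightarrow> 'b::real_normed_vector) \<Rightarrow> real^'d \<Rightarrow> 'b" where
  "partial k h x = frechet_derivative h (at x) (axis k 1)"

definition transport :: "('d::finite \<Rightarrow> 3) \<Rightarrow> (real^'d \<Rightarrow> vdist) \<Rightarrow> real^'d \<Rightarrow> vdist" where
  "transport \<iota> f x v = (\<Sum>k\<in>UNIV. v $ \<iota> k * partial k (\<lambda>y. f y v) x)"

type_synonym flux = "(real^3) \<times> (real^3^3) \<times> (real^3)"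

definition euler_flux :: "state \<Rightarrow> flux" where
  "euler_flux u =
     (mass_density u *\<^sub>R mean_velocity u,
      (\<chi> i j. mass_density u * mean_velocity u $ i * mean_velocity u $ j) + mat (pressure u),
      energy u *\<^sub>R mean_velocity u + pressure u *\<^sub>R mean_velocity u)"

definition flux_div :: "('d::finite \<Rightarrow> 3) \<Rightarrow> (real^'d \<Rightarrow> flux) \<Rightarrow> real^'d \<Rightarrow> state" where
  "flux_div \<iota> \<Phi> x =
     (\<Sum>k\<in>UNIV. partial k (\<lambda>y. fst (\<Phi> y) $ \<iota> k) x,
      \<chi> i. \<Sum>k\<in>UNIV. partial k (\<lambda>y. fst (snd (\<Phi> y)) $ i $ \<iota> k) x,
      \<Sum>k\<in>UNIV. partial k (\<lambda>y. snd (snd (\<Phi> y)) $ \<iota> k) x)"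

text \<open>The stages \<open>1, \<dots>, \<nu>\<close> are the elements of a finite well-ordered type \<open>'s\<close> with
  \<open>\<nu> = CARD('s)\<close>; the last stage is \<open>Max UNIV\<close>.\<close>

definition imex_step ::
  "('d::finite \<Rightarrow> 3) \<Rightarrow> (real^'d) set \<Rightarrow> (real \<Rightarrow> real^3 \<Rightarrow> real) \<Rightarrow> real \<Rightarrow> real \<Rightarrow> real
   \<Rightarrow> real^('s::{finite,wellorder})^('s::{finite,wellorder}) \<Rightarrow> real^('s::{finite,wellorder})
   \<Rightarrow> real^('s::{finite,wellorder})^('s::{finite,wellorder}) \<Rightarrow> real^('s::{finite,wellorder})
   \<Rightarrow> (real^'d \<Rightarrow> vdist) \<Rightarrow> ('s::{finite,wellorder} \<Rightarrow> real^'d \<Rightarrow> vdist) \<Rightarrow> (real^'d \<Rightarrow> vdist) \<Rightarrow> bool"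
  where
  "imex_step \<iota> \<Omega> B \<mu> \<epsilon> \<Delta>t At wt A w fn F fn1 \<longleftrightarrow>
     (\<forall>i. \<forall>x\<in>\<Omega>. \<forall>v.
        F i x v = fn x v
          + \<Delta>t * (\<Sum>j | j < i. At $ i $ j * (\<mu> / \<epsilon> * g_B B \<mu> (F j x) v - transport \<iota> (F j) x v))
          + \<Delta>t * (\<Sum>j | j \<le> i. A $ i $ j * (\<mu> / \<epsilon>) * (maxwellian (F j x) v - F j x v))) \<and>
     (\<forall>x\<in>\<Omega>. \<forall>v.
        fn1 x v = fn x v
          + \<Delta>t * (\<Sum>i\<in>UNIV. wt $ i * (\<mu> / \<epsilon> * g_B B \<mu> (F i x) v - transport \<iota> (F i) x v))
          + \<Delta>t * (\<Sum>i\<in>UNIV. w $ i * (\<mu> / \<epsilon>) * (maxwellian (F i x) v - F i x v)))"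

text \<open>The first conjunct makes the divergences below meaningful, \<^const>\<open>frechet_derivative\<close> being total.\<close>

definition explicit_rk_euler ::
  "('d::finite \<Rightarrow> 3) \<Rightarrow> (real^'d) set \<Rightarrow> real
   \<Rightarrow> real^('s::{finite,wellorder})^('s::{finite,wellorder}) \<Rightarrow> real^('s::{finite,wellorder})
   \<Rightarrow> (real^'d \<Rightarrow> state) \<Rightarrow> ('s::{finite,wellorder} \<Rightarrow> real^'d \<Rightarrow> state) \<Rightarrow> (real^'d \<Rightarrow> state) \<Rightarrow> bool"
  where
  "explicit_rk_euler \<iota> \<Omega> \<Delta>t At wt un U un1 \<longleftrightarrow>
     (\<forall>i. \<forall>x\<in>\<Omega>. (\<lambda>y. euler_flux (U i y)) differentiable (at x)) \<and>
     (\<forall>i. \<forall>x\<in>\<Omega>.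
        U i x = un x - \<Delta>t *\<^sub>R (\<Sum>j | j < i. At $ i $ j *\<^sub>R flux_div \<iota> (\<lambda>y. euler_flux (U j y)) x)) \<and>
     (\<forall>x\<in>\<Omega>.
        un1 x = un x - \<Delta>t *\<^sub>R (\<Sum>i\<in>UNIV. wt $ i *\<^sub>R flux_div \<iota> (\<lambda>y. euler_flux (U i y)) x))"

text \<open>Of the smoothness of a stage only differentiability in space, for each fixed velocity, is required.\<close>

definition regular_dist :: "(real^'d::finite) set \<Rightarrow> (real^'d \<Rightarrow> vdist) \<Rightarrow> bool" where
  "regular_dist \<Omega> f \<longleftrightarrow>
     (\<forall>x\<in>\<Omega>. (\<forall>v. (\<lambda>y. f y v) differentiable (at x)) \<and>
            finite_moments (f x) \<and> mass_density (moments (f x)) > 0 \<and> temperature (moments (f x)) > 0)"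

definition converges_with_moments ::
  "(real^'d::finite) set \<Rightarrow> (real \<Rightarrow> real^'d \<Rightarrow> vdist) \<Rightarrow> (real^'d \<Rightarrow> vdist) \<Rightarrow> bool" where
  "converges_with_moments \<Omega> h h0 \<longleftrightarrow>
     (\<forall>x\<in>\<Omega>.
        (\<forall>v. ((\<lambda>\<epsilon>. h \<epsilon> x v) \<longlongrightarrow> h0 x v) (at_right 0)) \<and>
        (\<forall>\<^sub>F \<epsilon> in at_right 0. finite_moments (h \<epsilon> x)) \<and> finite_moments (h0 x) \<and>
        ((\<lambda>\<epsilon>. moments (h \<epsilon> x)) \<longlongrightarrow> moments (h0 x)) (at_right 0))"

text \<open>The formal limit: one may pass to the limit pointwise and in the moments of the stages, of their
  Maxwellians, of \<open>g\<close> and of the transport terms. No interchange of space derivatives with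
  velocity integrals is assumed.\<close>

definition kinetic_limit ::
  "('d::finite \<Rightarrow> 3) \<Rightarrow> (real^'d) set \<Rightarrow> (real \<Rightarrow> real^3 \<Rightarrow> real) \<Rightarrow> real
   \<Rightarrow> (real \<Rightarrow> real^'d \<Rightarrow> vdist) \<Rightarrow> (real^'d \<Rightarrow> vdist) \<Rightarrow> bool" where
  "kinetic_limit \<iota> \<Omega> B \<mu> F F0 \<longleftrightarrow>
     converges_with_moments \<Omega> F F0 \<and>
     converges_with_moments \<Omega> (\<lambda>\<epsilon> x. maxwellian (F \<epsilon> x)) (\<lambda>x. maxwellian (F0 x)) \<and>
     converges_with_moments \<Omega> (\<lambda>\<epsilon> x. g_B B \<mu> (F \<epsilon> x)) (\<lambda>x. g_B B \<mu> (F0 x)) \<and>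
     converges_with_moments \<Omega> (\<lambda>\<epsilon>. transport \<iota> (F \<epsilon>)) (transport \<iota> F0)"

end

theory Submission
  imports Defs "HOL-Probability.Distributions"
begin

text \<open>
  The limit rests on three facts about Maxwellians. Collisions do not change them, so that
  \<open>g_B\<close> vanishes on them (\<open>g_B_maxwellian\<close>); they have the moments of the distribution
  from which they are formed (\<open>maxwellian_moments\<close>); and their fluxes of mass, momentum and energy are
  the Euler fluxes of these moments (\<open>maxwellian_flux\<close>).

  At order \<open>1 / \<epsilon>\<close>, the scheme is a triangular system for the defects \<open>M[F] - F\<close> of the limit
  stages, with sources \<open>g(F)\<close> taken from earlier stages only. Stage by stage, invertibility of the implicit
  matrix turns the vanishing of the earlier defects and sources into the vanishing of the next defect;
  hence all limit stages are local Maxwellians (\<open>imex_stages_local_equilibrium\<close>).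

  At order \<open>1\<close>, the moments of a stage see only the transport terms, since the stiff terms conserve mass,
  momentum and energy (\<open>imex_stage_moments\<close>). It remains to recognise the moments of
  \<open>v \<cdot> \<nabla>\<^sub>x F\<close>, for a local Maxwellian \<open>F\<close>, as the divergence of the Euler flux
  (\<open>transport_moments_of_local_equilibrium\<close>). This asks for an exchange of space derivative and velocity
  integral, knowing only that \<open>F\<close> is differentiable in space for each velocity. The Gaussian shape
  supplies the rest: density, velocity and temperature can be read off from the logarithm of \<open>F\<close> at
  finitely many velocities and are therefore differentiable, and Gaussians with differentiable parameters have
  difference quotients with a common integrable bound.

  Finally, global stiff accuracy identifies the new distribution with the last stage
  (\<open>imex_last_stage\<close>), and the same identity between the coefficients turns the moment equation of the last
  stage into that of the update.
\<close>

section \<open>Velocity moments of a Gaussian\<close>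

lemma has_bochner_integral_prod_Basis:
  fixes f :: "'a::euclidean_space \<Rightarrow> real \<Rightarrow> real"
  assumes f: "\<And>b. b \<in> Basis \<Longrightarrow> integrable lborel (f b)"
  shows "has_bochner_integral lborel (\<lambda>x. \<Prod>b\<in>Basis. f b (x \<bullet> b)) (\<Prod>b\<in>Basis. \<integral>t. f b t \<partial>lborel)"
proof -
  interpret product_sigma_finite "\<lambda>_::'a. lborel :: real measure" ..
  have meas [measurable]: "(\<lambda>g. \<Sum>b\<in>Basis. g b *\<^sub>R b) \<in> (\<Pi>\<^sub>M b\<in>Basis. lborel) \<rightarrow>\<^sub>M (borel :: 'a measure)"
    by measurable
  have [measurable]: "f b \<in> borel_measurable borel" if "b \<in> Basis" for b
    using borel_measurable_integrable[OF f[OF that]] by simp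
  have eq: "(\<Prod>b\<in>Basis. f b ((\<Sum>b\<in>Basis. g b *\<^sub>R b) \<bullet> b)) = (\<Prod>b\<in>Basis. f b (g b))" for g :: "'a \<Rightarrow> real"
    by (intro prod.cong refl) simp
  have "has_bochner_integral (\<Pi>\<^sub>M b\<in>Basis. lborel)
      (\<lambda>g. \<Prod>b\<in>Basis. f b ((\<Sum>b\<in>Basis. g b *\<^sub>R b) \<bullet> b)) (\<Prod>b\<in>Basis. \<integral>t. f b t \<partial>lborel)"
    unfolding eq using f
    by (simp add: has_bochner_integral_iff product_integrable_prod product_integral_prod)
  then show ?thesis
    by (subst lborel_eq) (subst has_bochner_integral_distr, measurable)
qed

text \<open>Fubini in the form in which it is used for Gaussians: they are products of one-dimensional normal
  densities, so every monomial moment is a product of one-dimensional moments.\<close>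

lemma has_bochner_integral_prod_components:
  fixes f :: "'n::finite \<Rightarrow> real \<Rightarrow> real"
  assumes "\<And>i. integrable lborel (f i)"
  shows "has_bochner_integral lborel (\<lambda>v::real^'n. \<Prod>i\<in>UNIV. f i (v $ i)) (\<Prod>i\<in>UNIV. \<integral>t. f i t \<partial>lborel)"
proof -
  have Basis: "(Basis :: (real^'n) set) = range (\<lambda>i. axis i 1)"
    by (auto simp: Basis_vec_def)
  have inj: "inj (\<lambda>i::'n. axis i (1::real))"
    by (auto simp: inj_def axis_eq_axis)
  define g where "g b = f (inv (\<lambda>i::'n. axis i (1::real)) b)" for b
  have g: "g (axis i 1) = f i" for i
    by (simp add: g_def inv_f_f [OF inj])
  have "has_bochner_integral lborel (\<lambda>x::real^'n. \<Prod>b\<in>Basis. g b (x \<bullet> b)) (\<Prod>b\<in>Basis. \<integral>t. g b t \<partial>lborel)"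
    by (rule has_bochner_integral_prod_Basis) (auto simp: g_def assms)
  then show ?thesis
    unfolding Basis by (simp add: prod.reindex[OF inj] g inner_axis o_def)
qed

definition gaussian :: "real \<Rightarrow> real^3 \<Rightarrow> real \<Rightarrow> vdist" where
  "gaussian \<rho> w T v = \<rho> / (2 * pi * T) powr (3/2) * exp (- (norm (w - v))\<^sup>2 / (2 * T))"

lemma maxwellian_eq_gaussian:
  "maxwellian f = gaussian (mass_density (moments f)) (mean_velocity (moments f)) (temperature (moments f))"
  by (auto simp: maxwellian_def gaussian_def Let_def)

lemma gaussian_eq_prod_normal_density:
  assumes "T > 0"
  shows "gaussian \<rho> w T v = \<rho> * (\<Prod>i\<in>UNIV. normal_density (w $ i) (sqrt T) (v $ i))"
proof -
  have "(norm (w - v))\<^sup>2 = (\<Sum>i\<in>UNIV. (v $ i - w $ i)\<^sup>2)"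
    unfolding power2_norm_eq_inner inner_vec_def by (simp add: power2_eq_square algebra_simps)
  moreover have "(2 * pi * T) powr (3/2) = (sqrt (2 * pi * T)) ^ 3"
    using assms by (simp add: powr_half_sqrt_powr powr_realpow real_sqrt_power)
  ultimately show ?thesis
    using assms
    by (simp add: gaussian_def normal_density_def prod_dividef exp_sum [symmetric] prod.distrib
        sum_divide_distrib sum_negf power_divide)
qed

lemma gaussian_central_moment:
  assumes "T > 0"
  shows "has_bochner_integral lborel (\<lambda>v. gaussian \<rho> w T v * (\<Prod>i\<in>UNIV. (v $ i - w $ i) ^ p i))
    (\<rho> * (\<Prod>i\<in>UNIV. \<integral>t. normal_density (w $ i) (sqrt T) t * (t - w $ i) ^ p i \<partial>lborel))"
proof -
  have "has_bochner_integral lborel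
      (\<lambda>v::real^3. \<Prod>i\<in>UNIV. normal_density (w $ i) (sqrt T) (v $ i) * (v $ i - w $ i) ^ p i)
      (\<Prod>i\<in>UNIV. \<integral>t. normal_density (w $ i) (sqrt T) t * (t - w $ i) ^ p i \<partial>lborel)"
    using assms by (intro has_bochner_integral_prod_components integrable_normal_moment) simp
  from has_bochner_integral_mult_right[OF this, of \<rho>] show ?thesis
    using assms by (simp add: gaussian_eq_prod_normal_density prod.distrib mult.assoc)
qed


lemma integral_normal_central_moment_odd:
  assumes "\<sigma> > 0" "odd p"
  shows "(\<integral>t. normal_density \<mu> \<sigma> t * (t - \<mu>) ^ p \<partial>lborel) = 0"
  using assms integral_normal_moment_odd by (auto elim!: oddE)

text \<open>The reflection of a single velocity component about the mean makes every monomial of odd degree in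
  that component integrate to zero. Of the central moments up to order three, this leaves only the
  mass and the variances.\<close>

lemma gaussian_central_moment_odd:
  assumes "T > 0" "odd (p j)"
  shows "has_bochner_integral lborel (\<lambda>v. gaussian \<rho> w T v * (\<Prod>i\<in>UNIV. (v $ i - w $ i) ^ p i)) 0"
proof -
  have "(\<Prod>i\<in>UNIV. \<integral>t. normal_density (w $ i) (sqrt T) t * (t - w $ i) ^ p i \<partial>lborel) = 0"
    using assms by (intro prod_zero bexI[of _ j]) (simp_all add: integral_normal_central_moment_odd)
  then show ?thesis
    using gaussian_central_moment[OF assms(1), of \<rho> w p] by (simp only: mult_zero_right)
qed

lemma prod_power_single:
  fixes z :: "'i::finite \<Rightarrow> real"
  shows "(\<Prod>i\<in>UNIV. z i ^ (if i = j then n else 0)) = z j ^ n"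
proof -
  have "(\<Prod>i\<in>UNIV. z i ^ (if i = j then n else 0)) = (\<Prod>i\<in>UNIV. if i = j then z i ^ n else 1)"
    by (intro prod.cong) auto
  then show ?thesis by simp
qed

lemma gaussian_mass:
  assumes "T > 0"
  shows "has_bochner_integral lborel (gaussian \<rho> w T) \<rho>"
  using gaussian_central_moment[OF assms, of \<rho> w "\<lambda>_. 0"] assms by simp

lemma gaussian_central_1:
  assumes "T > 0"
  shows "has_bochner_integral lborel (\<lambda>v. gaussian \<rho> w T v * (v $ j - w $ j)) 0"
  using gaussian_central_moment_odd[OF assms, of "\<lambda>i. if i = j then 1 else 0" j \<rho> w]
  by (simp add: prod_power_single)

lemma gaussian_central_2:
  assumes "T > 0"
  shows "has_bochner_integral lborel (\<lambda>v. gaussian \<rho> w T v * ((v $ i - w $ i) * (v $ j - w $ j)))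
    (if i = j then \<rho> * T else 0)"
proof (cases "i = j")
  case True
  have "(\<Prod>k\<in>UNIV. \<integral>t. normal_density (w $ k) (sqrt T) t * (t - w $ k) ^ (if k = j then 2 else 0) \<partial>lborel)
      = (\<Prod>k\<in>UNIV. if k = j then T else 1)"
    using assms integral_normal_moment_even[of "sqrt T" _ 1]
    by (intro prod.cong refl) simp
  then show ?thesis
    using gaussian_central_moment[OF assms, of \<rho> w "\<lambda>k. if k = j then 2 else 0"] True
    by (simp add: prod_power_single power2_eq_square)
next
  case False
  then show ?thesis
    using gaussian_central_moment_odd[OF assms, of "\<lambda>k. (if k = i then 1 else 0) + (if k = j then 1 else 0)" i \<rho> w]
    by (simp add: power_add prod.distrib prod_power_single)
qed

lemma gaussian_central_3:
  assumes "T > 0"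
  shows "has_bochner_integral lborel (\<lambda>v. gaussian \<rho> w T v * ((v $ i - w $ i) * (v $ j - w $ j)\<^sup>2)) 0"
  using gaussian_central_moment_odd[OF assms, of "\<lambda>k. (if k = i then 1 else 0) + (if k = j then 2 else 0)" i \<rho> w]
  by (simp add: power_add prod.distrib prod_power_single)

text \<open>The raw moments follow from the central ones by writing \<open>v = w + (v - w)\<close>.\<close>

lemma gaussian_momentum:
  assumes "T > 0"
  shows "has_bochner_integral lborel (\<lambda>v. gaussian \<rho> w T v * v $ j) (\<rho> * w $ j)"
proof -
  have "has_bochner_integral lborel
      (\<lambda>v. gaussian \<rho> w T v * (v $ j - w $ j) + gaussian \<rho> w T v * w $ j) (0 + \<rho> * w $ j)"
    using assms by (intro has_bochner_integral_add has_bochner_integral_mult_left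
        gaussian_central_1 gaussian_mass)
  then show ?thesis by (simp add: algebra_simps)
qed

lemma gaussian_momentum_flux:
  assumes "T > 0"
  shows "has_bochner_integral lborel (\<lambda>v. gaussian \<rho> w T v * (v $ i * v $ j))
    (\<rho> * w $ i * w $ j + (if i = j then \<rho> * T else 0))"
proof -
  have "has_bochner_integral lborel
      (\<lambda>v. gaussian \<rho> w T v * ((v $ i - w $ i) * (v $ j - w $ j)) + gaussian \<rho> w T v * v $ i * w $ j
        + gaussian \<rho> w T v * (v $ j - w $ j) * w $ i)
      ((if i = j then \<rho> * T else 0) + \<rho> * w $ i * w $ j + 0 * w $ i)"
    using assms by (intro has_bochner_integral_add has_bochner_integral_mult_left
        gaussian_central_1 gaussian_central_2 gaussian_momentum)
  then show ?thesis by (simp add: algebra_simps)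
qed

lemma norm_squared_eq_sum_components:
  fixes v :: "real^'n"
  shows "(norm v)\<^sup>2 = (\<Sum>j\<in>UNIV. (v $ j)\<^sup>2)"
  unfolding power2_norm_eq_inner inner_vec_def by (simp add: power2_eq_square)

lemma gaussian_energy:
  assumes "T > 0"
  shows "has_bochner_integral lborel (\<lambda>v. gaussian \<rho> w T v * ((norm v)\<^sup>2 / 2))
    ((3 * \<rho> * T + \<rho> * (norm w)\<^sup>2) / 2)"
proof -
  have "has_bochner_integral lborel (\<lambda>v. (\<Sum>j\<in>UNIV. gaussian \<rho> w T v * (v $ j * v $ j)) / 2)
      ((\<Sum>j\<in>UNIV. \<rho> * w $ j * w $ j + (if j = j then \<rho> * T else 0)) / 2)"
    using assms by (intro has_bochner_integral_divide_zero has_bochner_integral_sum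
        gaussian_momentum_flux)
  then show ?thesis
    by (rule has_bochner_integral_cong[THEN iffD1, rotated -1])
      (simp_all only: norm_squared_eq_sum_components, simp_all add: sum_distrib_left sum.distrib
        sum_divide_distrib algebra_simps power2_eq_square)
qed

text \<open>The heat flux of a Gaussian is a central moment of odd order and vanishes. What remains is the
  convected energy \<open>E * w\<close> and the work of the pressure \<open>\<rho> * T * w\<close>, which is why the limit closes
  at the Euler level.\<close>

lemma gaussian_energy_flux:
  assumes "T > 0"
  shows "has_bochner_integral lborel (\<lambda>v. gaussian \<rho> w T v * (v $ k * ((norm v)\<^sup>2 / 2)))
    (((3 * \<rho> * T + \<rho> * (norm w)\<^sup>2) / 2 + \<rho> * T) * w $ k)"
proof -
  let ?g = "gaussian \<rho> w T"
  have summand: "has_bochner_integral lborel (\<lambda>v. ?g v * (v $ k * (v $ j)\<^sup>2))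
      (w $ k * (\<rho> * w $ j * w $ j + \<rho> * T) + (if k = j then 2 * w $ j * (\<rho> * T) else 0))" for j
  proof -
    have "has_bochner_integral lborel
        (\<lambda>v. ?g v * (v $ j * v $ j) * w $ k + ?g v * (v $ k - w $ k) * (w $ j)\<^sup>2
          + ?g v * ((v $ k - w $ k) * (v $ j - w $ j)) * (2 * w $ j)
          + ?g v * ((v $ k - w $ k) * (v $ j - w $ j)\<^sup>2))
        ((\<rho> * w $ j * w $ j + (if j = j then \<rho> * T else 0)) * w $ k + 0 * (w $ j)\<^sup>2
          + (if k = j then \<rho> * T else 0) * (2 * w $ j) + 0)"
      using assms by (intro has_bochner_integral_add has_bochner_integral_mult_left
          gaussian_central_1 gaussian_central_2 gaussian_central_3 gaussian_momentum_flux)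
    then show ?thesis
      by (rule has_bochner_integral_cong[THEN iffD1, rotated -1])
        (auto simp: algebra_simps power2_eq_square)
  qed
  have "has_bochner_integral lborel (\<lambda>v. (\<Sum>j\<in>UNIV. ?g v * (v $ k * (v $ j)\<^sup>2)) / 2)
      ((\<Sum>j\<in>UNIV. w $ k * (\<rho> * w $ j * w $ j + \<rho> * T) + (if k = j then 2 * w $ j * (\<rho> * T) else 0)) / 2)"
    by (intro has_bochner_integral_divide_zero has_bochner_integral_sum summand)
  then show ?thesis
    by (rule has_bochner_integral_cong[THEN iffD1, rotated -1])
      (simp_all only: norm_squared_eq_sum_components, simp_all add: sum_distrib_left sum.distrib
        sum_divide_distrib algebra_simps power2_eq_square)
qed

lemma has_bochner_integral_Pair:
  fixes f :: "'a \<Rightarrow> 'b::{second_countable_topology,banach}"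
    and g :: "'a \<Rightarrow> 'c::{second_countable_topology,banach}"
  assumes "has_bochner_integral M f a" "has_bochner_integral M g b"
  shows "has_bochner_integral M (\<lambda>x. (f x, g x)) (a, b)"
proof -
  have f: "has_bochner_integral M (\<lambda>x. (f x, 0 :: 'c)) (a, 0)"
    by (rule has_bochner_integral_bounded_linear[OF _ assms(1)])
      (intro bounded_linear_Pair bounded_linear_ident bounded_linear_zero)
  have g: "has_bochner_integral M (\<lambda>x. (0 :: 'b, g x)) (0, b)"
    by (rule has_bochner_integral_bounded_linear[OF _ assms(2)])
      (intro bounded_linear_Pair bounded_linear_ident bounded_linear_zero)
  show ?thesis
    using has_bochner_integral_add[OF f g] by simp
qed

lemma has_bochner_integral_vec:
  fixes f :: "'a \<Rightarrow> real^'n"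
  assumes "\<And>i. has_bochner_integral M (\<lambda>x. f x $ i) (a $ i)"
  shows "has_bochner_integral M f a"
proof -
  have eq: "(\<Sum>i\<in>UNIV. y $ i *\<^sub>R axis i 1) = y" for y :: "real^'n"
    using basis_expansion[of y] by (simp add: scalar_mult_eq_scaleR)
  have "has_bochner_integral M (\<lambda>x. \<Sum>i\<in>UNIV. f x $ i *\<^sub>R axis i (1::real)) (\<Sum>i\<in>UNIV. a $ i *\<^sub>R axis i 1)"
    using assms by (intro has_bochner_integral_sum has_bochner_integral_scaleR_left)
  then show ?thesis
    by (simp add: eq)
qed

text \<open>Gathering the fluxes of all invariants in one direction into a state makes the divergence of the
  flux a sum of partial derivatives of state-valued functions.\<close>

definition flux_column :: "3 \<Rightarrow> flux \<Rightarrow> state" where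
  "flux_column k \<Phi> = (fst \<Phi> $ k, \<chi> i. fst (snd \<Phi>) $ i $ k, snd (snd \<Phi>) $ k)"

lemma state_eq_hydrodynamic:
  assumes "mass_density u > 0"
  shows "u = (mass_density u, mass_density u *\<^sub>R mean_velocity u,
     (3 * mass_density u * temperature u + mass_density u * (norm (mean_velocity u))\<^sup>2) / 2)"
  using assms
  by (cases u) (simp add: mass_density_def mean_velocity_def temperature_def energy_def field_simps)

lemma maxwellian_moments:
  assumes "mass_density (moments f) > 0" "temperature (moments f) > 0"
  shows "has_bochner_integral lborel (\<lambda>v. maxwellian f v *\<^sub>R invariants v) (moments f)"
  using assms(2)
  by (subst state_eq_hydrodynamic[OF assms(1)])
    (auto simp: maxwellian_eq_gaussian invariants_def
      intro!: has_bochner_integral_Pair has_bochner_integral_vec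
        gaussian_mass gaussian_momentum gaussian_energy[unfolded times_divide_eq_right])

text \<open>The moment closure: the velocity-weighted moments of a Maxwellian are determined by its
  hydrodynamic state, through the Euler flux.\<close>

lemma maxwellian_flux:
  assumes "mass_density (moments f) > 0" "temperature (moments f) > 0"
  shows "has_bochner_integral lborel (\<lambda>v. maxwellian f v *\<^sub>R (v $ k *\<^sub>R invariants v))
    (flux_column k (euler_flux (moments f)))"
proof -
  let ?u = "moments f"
  let ?\<rho> = "mass_density ?u" and ?w = "mean_velocity ?u" and ?T = "temperature ?u"
  have E: "energy ?u = (3 * ?\<rho> * ?T + ?\<rho> * (norm ?w)\<^sup>2) / 2"
    using arg_cong[OF state_eq_hydrodynamic[OF assms(1)], of energy] by (simp add: energy_def)
  have flux: "flux_column k (euler_flux ?u) =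
      (?\<rho> * ?w $ k, \<chi> i. ?\<rho> * ?w $ i * ?w $ k + (if i = k then ?\<rho> * ?T else 0),
       ((3 * ?\<rho> * ?T + ?\<rho> * (norm ?w)\<^sup>2) / 2 + ?\<rho> * ?T) * ?w $ k)"
    by (simp add: flux_column_def euler_flux_def E pressure_def mat_def vec_eq_iff algebra_simps)
  have eq: "(\<lambda>v. maxwellian f v *\<^sub>R (v $ k *\<^sub>R invariants v)) = (\<lambda>v. (maxwellian f v * v $ k,
      \<chi> i. maxwellian f v * (v $ i * v $ k), maxwellian f v * (v $ k * ((norm v)\<^sup>2 / 2))))"
    by (auto simp: invariants_def vec_eq_iff)
  show ?thesis
    unfolding flux eq unfolding maxwellian_eq_gaussian using assms(2)
    by (intro has_bochner_integral_Pair has_bochner_integral_vec gaussian_momentum gaussian_energy_flux)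
      (simp_all only: vec_lambda_beta gaussian_momentum_flux)
qed

section \<open>Differentiation under the velocity integral\<close>

text \<open>A sequence of difference quotients is what the dominated convergence theorem asks for.\<close>

lemma difference_quotients_tendsto_partial:
  assumes "h differentiable (at x)"
  shows "(\<lambda>n. (h (x + (1 / Suc n) *\<^sub>R axis k 1) - h x) /\<^sub>R (1 / Suc n)) \<longlonglongrightarrow> partial k h x"
proof -
  let ?D = "frechet_derivative h (at x)" and ?e = "axis k 1 :: real^'a"
  let ?t = "\<lambda>n. 1 / real (Suc n)"
  have D: "bounded_linear ?D" and lim: "((\<lambda>d. norm (h (x + d) - h x - ?D d) / norm d) \<longlongrightarrow> 0) (at 0)"
    using assms unfolding frechet_derivative_works has_derivative_at by auto
  have "(\<lambda>n. ?t n *\<^sub>R ?e) \<longlonglongrightarrow> 0 *\<^sub>R ?e"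
    by (intro tendsto_scaleR tendsto_const) (rule LIMSEQ_inverse_real_of_nat[unfolded inverse_eq_divide])
  moreover have "?t n *\<^sub>R ?e \<noteq> 0" for n
    by (simp add: axis_eq_0_iff)
  ultimately have "filterlim (\<lambda>n. ?t n *\<^sub>R ?e) (at 0) sequentially"
    unfolding filterlim_at by simp
  then have "(\<lambda>n. norm (h (x + ?t n *\<^sub>R ?e) - h x - ?D (?t n *\<^sub>R ?e)) / norm (?t n *\<^sub>R ?e)) \<longlonglongrightarrow> 0"
    by (rule filterlim_compose[OF lim])
  moreover have "norm (h (x + ?t n *\<^sub>R ?e) - h x - ?D (?t n *\<^sub>R ?e)) / norm (?t n *\<^sub>R ?e)
      = norm ((h (x + ?t n *\<^sub>R ?e) - h x) /\<^sub>R ?t n - ?D ?e)" for n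
  proof -
    have "(h (x + ?t n *\<^sub>R ?e) - h x) /\<^sub>R ?t n - ?D ?e = (h (x + ?t n *\<^sub>R ?e) - h x - ?D (?t n *\<^sub>R ?e)) /\<^sub>R ?t n"
      by (simp add: linear_cmul[OF bounded_linear.linear[OF D]] scaleR_diff_right)
    then show ?thesis
      by (simp add: divide_inverse mult.commute)
  qed
  ultimately have "(\<lambda>n. norm ((h (x + ?t n *\<^sub>R ?e) - h x) /\<^sub>R ?t n - ?D ?e)) \<longlonglongrightarrow> 0"
    by simp
  then show ?thesis
    unfolding partial_def by (simp only: tendsto_norm_zero_iff LIM_zero_iff)
qed

text \<open>Differentiation under the integral sign at a single point. Only differentiability at \<open>x\<close> is
  available, and no derivative near \<open>x\<close>, so the domination is a Lipschitz bound relative to \<open>x\<close>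
  instead of a bound on the derivatives. As the integral itself is known to be differentiable,
  identifying the limit of its difference quotients along one sequence suffices.\<close>

lemma partial_has_bochner_integral:
  fixes h :: "real^'d \<Rightarrow> 'a \<Rightarrow> 'b::{banach, second_countable_topology}"
  assumes diff: "\<And>v. (\<lambda>y. h y v) differentiable (at x)"
    and int: "\<forall>\<^sub>F y in nhds x. has_bochner_integral M (h y) (\<Phi> y)"
    and \<Phi>: "\<Phi> differentiable (at x)"
    and lip: "\<forall>\<^sub>F y in nhds x. \<forall>v. norm (h y v - h x v) \<le> norm (y - x) * G v"
    and G: "integrable M G"
  shows "has_bochner_integral M (\<lambda>v. partial k (\<lambda>y. h y v) x) (partial k \<Phi> x)"
proof -
  let ?t = "\<lambda>n. 1 / real (Suc n)"
  let ?y = "\<lambda>n. x + ?t n *\<^sub>R axis k 1 :: real^'d"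
  have "?y \<longlonglongrightarrow> x + 0 *\<^sub>R axis k 1"
    by (intro tendsto_add tendsto_scaleR tendsto_const)
      (rule LIMSEQ_inverse_real_of_nat[unfolded inverse_eq_divide])
  then have "filterlim ?y (nhds x) sequentially" by simp
  from eventually_compose_filterlim[OF eventually_conj[OF int lip] this]
  obtain N where N: "\<And>n. n \<ge> N \<Longrightarrow> has_bochner_integral M (h (?y n)) (\<Phi> (?y n)) \<and>
      (\<forall>v. norm (h (?y n) v - h x v) \<le> norm (?y n - x) * G v)"
    unfolding eventually_sequentially by blast
  have x: "has_bochner_integral M (h x) (\<Phi> x)"
    using int by (rule eventually_nhds_x_imp_x)
  define q where "q n v = (h (?y (n + N)) v - h x v) /\<^sub>R ?t (n + N)" for n v
  define Q where "Q n = (\<Phi> (?y (n + N)) - \<Phi> x) /\<^sub>R ?t (n + N)" for n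
  have q: "has_bochner_integral M (q n) (Q n)" for n
    unfolding q_def Q_def using N[of "n + N"] x
    by (intro has_bochner_integral_scaleR_right has_bochner_integral_diff) auto
  then have meas: "q n \<in> borel_measurable M" for n
    by (meson borel_measurable_integrable integrable.intros)
  have lim: "(\<lambda>n. q n v) \<longlonglongrightarrow> partial k (\<lambda>y. h y v) x" for v
    unfolding q_def by (rule LIMSEQ_ignore_initial_segment[OF difference_quotients_tendsto_partial[OF diff]])
  have Q: "Q \<longlonglongrightarrow> partial k \<Phi> x"
    unfolding Q_def by (rule LIMSEQ_ignore_initial_segment[OF difference_quotients_tendsto_partial[OF \<Phi>]])
  have bound: "norm (q n v) \<le> G v" for n v
  proof -
    define t where "t = ?t (n + N)"
    have t: "t > 0" by (simp add: t_def)
    have "norm (?y (n + N) - x) = t"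
      by (simp add: norm_axis_1 t_def)
    then have "norm (h (?y (n + N)) v - h x v) \<le> t * G v"
      using N[of "n + N"] by (metis le_add2)
    moreover have "norm (q n v) = norm (h (?y (n + N)) v - h x v) / t"
      using t unfolding q_def t_def [symmetric] by (simp add: divide_inverse mult.commute)
    ultimately show ?thesis
      using t by (simp add: pos_divide_le_eq mult.commute)
  qed
  have pm: "(\<lambda>v. partial k (\<lambda>y. h y v) x) \<in> borel_measurable M"
    by (rule borel_measurable_LIMSEQ_metric[OF meas lim])
  have "integrable M (\<lambda>v. partial k (\<lambda>y. h y v) x)"
    by (rule integrable_dominated_convergence[where s = q, OF pm meas G]) (simp_all add: lim bound)
  moreover have "(\<lambda>n. integral\<^sup>L M (q n)) \<longlonglongrightarrow> (\<integral>v. partial k (\<lambda>y. h y v) x \<partial>M)"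
    by (rule integral_dominated_convergence[where s = q, OF pm meas G]) (simp_all add: lim bound)
  moreover have "(\<lambda>n. integral\<^sup>L M (q n)) = Q"
    using q has_bochner_integral_integral_eq by blast
  ultimately show ?thesis
    using Q LIMSEQ_unique by (auto simp: has_bochner_integral_iff)
qed

lemma differentiable_imp_Lipschitz_at:
  fixes f :: "'a::real_normed_vector \<Rightarrow> 'b::real_normed_vector"
  assumes "f differentiable (at x)"
  obtains L where "L \<ge> 0" "\<forall>\<^sub>F y in nhds x. norm (f y - f x) \<le> L * norm (y - x)"
proof -
  obtain D where D: "(f has_derivative D) (at x)"
    using assms unfolding differentiable_def by blast
  then have lin: "bounded_linear D" by (rule has_derivative_bounded_linear)
  obtain K where K: "K \<ge> 0" "\<And>z. norm (D z) \<le> norm z * K"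
    using bounded_linear.nonneg_bounded[OF lin] by auto
  obtain d where d: "d > 0" "\<And>y. norm (y - x) < d \<Longrightarrow> norm (f y - f x - D (y - x)) \<le> 1 * norm (y - x)"
    using D unfolding has_derivative_at_alt using zero_less_one by blast
  have "norm (f y - f x) \<le> (K + 1) * norm (y - x)" if "dist y x < d" for y
  proof -
    have "norm (f y - f x) \<le> norm (f y - f x - D (y - x)) + norm (D (y - x))"
      by (metis norm_triangle_sub add.commute)
    then show ?thesis
      using d(2)[of y] K(2)[of "y - x"] that by (simp add: dist_norm algebra_simps)
  qed
  then show ?thesis
    using K(1) d(1) by (intro that[of "K + 1"]) (auto simp: eventually_nhds_metric)
qed

lemma abs_exp_diff_le:
  fixes p q r :: real
  assumes "p \<le> r" "q \<le> r"
  shows "\<bar>exp p - exp q\<bar> \<le> \<bar>p - q\<bar> * exp r"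
proof -
  have *: "exp p - exp q \<le> (p - q) * exp r" if "q \<le> p" "p \<le> r" for p q
  proof -
    have "exp p - exp q = exp p * (1 - exp (q - p))"
      by (simp add: exp_diff algebra_simps)
    also have "\<dots> \<le> exp p * (p - q)"
      using exp_ge_add_one_self[of "q - p"] by (intro mult_left_mono) (linarith, simp)
    also have "\<dots> \<le> exp r * (p - q)"
      using that by (intro mult_right_mono) auto
    finally show ?thesis by (simp add: mult.commute)
  qed
  show ?thesis
    using *[of q p] *[of p q] assms by (cases "q \<le> p") (auto simp: abs_if)
qed

text \<open>The dominating function for \<open>partial_has_bochner_integral\<close>. Near \<open>x\<close> the coefficient of the
  quadratic term stays above half its value at \<open>x\<close>, so that both exponentials have a common Gaussian
  bound. A power of \<open>1 + norm v\<close> is at most \<open>exp (n * norm v)\<close> with the same exponent \<open>n\<close>, and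
  this factor is absorbed by giving up another half of the Gaussian decay.\<close>

lemma exp_quadratic_Lipschitz:
  fixes a c :: "'a::real_normed_vector \<Rightarrow> real" and b :: "'a \<Rightarrow> 'v::real_inner"
  assumes "a differentiable (at x)" "b differentiable (at x)" "c differentiable (at x)" "c x > 0"
  obtains K \<gamma> where "\<gamma> > 0" "\<forall>\<^sub>F y in nhds x. \<forall>v.
      \<bar>exp (a y + b y \<bullet> v - c y * (norm v)\<^sup>2) - exp (a x + b x \<bullet> v - c x * (norm v)\<^sup>2)\<bar> * (1 + norm v) ^ m
        \<le> norm (y - x) * (K * exp (- \<gamma> * (norm v)\<^sup>2))"
proof -
  define f where "f y = (a y, b y, c y)" for y
  have "f differentiable (at x)"
    unfolding f_def using assms(1-3) by (intro differentiable_Pair)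
  then obtain L where L: "L \<ge> 0" and ev: "\<forall>\<^sub>F y in nhds x. norm (f y - f x) \<le> L * norm (y - x)"
    by (rule differentiable_imp_Lipschitz_at)
  define \<kappa> \<alpha> \<beta> where "\<kappa> = c x / 2" and "\<alpha> = \<bar>a x\<bar> + 1" and "\<beta> = norm (b x) + 1"
  have \<kappa>: "\<kappa> > 0" using assms(4) by (simp add: \<kappa>_def)
  define M where "M = \<beta> + real (m + 2)"
  define K where "K = L * exp (\<alpha> + M\<^sup>2 / (2 * \<kappa>))"
  have "((\<lambda>y. L * norm (y - x)) \<longlongrightarrow> L * norm (x - x)) (nhds x)"
    by (intro tendsto_mult tendsto_norm tendsto_diff tendsto_const filterlim_ident)
  then have "\<forall>\<^sub>F y in nhds x. L * norm (y - x) < min 1 \<kappa>"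
    using \<kappa> by (intro order_tendstoD) auto
  with ev have "\<forall>\<^sub>F y in nhds x. \<forall>v.
      \<bar>exp (a y + b y \<bullet> v - c y * (norm v)\<^sup>2) - exp (a x + b x \<bullet> v - c x * (norm v)\<^sup>2)\<bar> * (1 + norm v) ^ m
        \<le> norm (y - x) * (K * exp (- (\<kappa> / 2) * (norm v)\<^sup>2))"
  proof eventually_elim
    case (elim y)
    \<comment> \<open>The common bound for the changes of all three coefficients; it is at most \<open>1\<close> and \<open>\<kappa>\<close> near \<open>x\<close>.\<close>
    define D where "D = L * norm (y - x)"
    have D: "D \<ge> 0" "D \<le> 1" "D \<le> \<kappa>" using L elim by (auto simp: D_def)
    have f: "norm (a y - a x, b y - b x, c y - c x) \<le> D"
      using elim by (simp add: f_def D_def)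
    have a: "\<bar>a y - a x\<bar> \<le> D"
      using norm_fst_le[of "a y - a x" "(b y - b x, c y - c x)"] f by simp
    have bc: "norm (b y - b x, c y - c x) \<le> D"
      using norm_snd_le[of "(b y - b x, c y - c x)" "a y - a x"] f by simp
    have b: "norm (b y - b x) \<le> D"
      using norm_fst_le[of "b y - b x" "c y - c x"] bc by simp
    have c: "\<bar>c y - c x\<bar> \<le> D"
      using norm_snd_le[of "c y - c x" "b y - b x"] bc by simp
    show ?case
    proof
      fix v :: 'v
      define s where "s = norm v"
      have s: "s \<ge> 0" by (simp add: s_def)
      let ?p = "a y + b y \<bullet> v - c y * s\<^sup>2" and ?q = "a x + b x \<bullet> v - c x * s\<^sup>2"
      let ?r = "\<alpha> + \<beta> * s - \<kappa> * s\<^sup>2"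
      have "\<bar>(b y - b x) \<bullet> v\<bar> \<le> D * s"
        using Cauchy_Schwarz_ineq2[of "b y - b x" v] mult_right_mono[OF b s] by (simp add: s_def)
      moreover have "\<bar>(c y - c x) * s\<^sup>2\<bar> \<le> D * s\<^sup>2"
        using c by (simp add: abs_mult mult_right_mono)
      ultimately have "\<bar>?p - ?q\<bar> \<le> D + D * s + D * s\<^sup>2"
        using a by (simp add: inner_diff_left algebra_simps abs_le_iff)
      also have "\<dots> \<le> D * (1 + s)\<^sup>2"
        using D(1) s by (simp add: power2_eq_square algebra_simps)
      finally have pq: "\<bar>?p - ?q\<bar> \<le> D * (1 + s)\<^sup>2" .
      have "norm (b y) \<le> \<beta>"
        using norm_triangle_sub[of "b y" "b x"] b D(2) by (simp add: \<beta>_def)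
      then have "b y \<bullet> v \<le> \<beta> * s"
        using norm_cauchy_schwarz[of "b y" v] mult_right_mono[of "norm (b y)" \<beta> s] s
        by (simp add: s_def)
      moreover have "\<kappa> * s\<^sup>2 \<le> c y * s\<^sup>2"
        using c D(3) by (intro mult_right_mono) (auto simp: \<kappa>_def)
      moreover have "a y \<le> \<alpha>" using a D(2) by (simp add: \<alpha>_def)
      ultimately have p: "?p \<le> ?r" by simp
      have "b x \<bullet> v \<le> norm (b x) * s"
        unfolding s_def by (rule norm_cauchy_schwarz)
      moreover have "norm (b x) * s \<le> \<beta> * s"
        using s by (intro mult_right_mono) (auto simp: \<beta>_def)
      moreover have "\<kappa> * s\<^sup>2 \<le> c x * s\<^sup>2"
        using \<kappa> by (intro mult_right_mono) (auto simp: \<kappa>_def)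
      moreover have "a x \<le> \<alpha>" by (simp add: \<alpha>_def)
      ultimately have q: "?q \<le> ?r" by simp
      have "(1 + s) ^ (m + 2) \<le> exp s ^ (m + 2)"
        using s exp_ge_add_one_self[of s] by (intro power_mono) auto
      also have "\<dots> = exp (real (m + 2) * s)"
        by (rule exp_of_nat_mult [symmetric])
      finally have pow: "(1 + s) ^ (m + 2) \<le> exp (real (m + 2) * s)" .
      \<comment> \<open>Completing the square trades the linear term for half of the quadratic decay.\<close>
      have "0 \<le> (M - \<kappa> * s)\<^sup>2 / (2 * \<kappa>)"
        using \<kappa> by simp
      also have "\<dots> = M\<^sup>2 / (2 * \<kappa>) - M * s + \<kappa> / 2 * s\<^sup>2"
        using \<kappa> by (simp add: power2_eq_square field_simps)
      finally have square: "M * s - \<kappa> * s\<^sup>2 \<le> M\<^sup>2 / (2 * \<kappa>) - \<kappa> / 2 * s\<^sup>2"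
        by simp
      have "\<bar>exp ?p - exp ?q\<bar> * (1 + s) ^ m \<le> D * (1 + s)\<^sup>2 * exp ?r * (1 + s) ^ m"
        using s by (intro mult_right_mono order_trans[OF abs_exp_diff_le[OF p q] mult_right_mono[OF pq]]) auto
      also have "\<dots> = D * exp ?r * (1 + s) ^ (m + 2)"
        by (simp add: power_add power2_eq_square)
      also have "\<dots> \<le> D * exp ?r * exp (real (m + 2) * s)"
        using pow D(1) by (intro mult_left_mono) auto
      also have "\<dots> = D * exp (\<alpha> + (M * s - \<kappa> * s\<^sup>2))"
        by (simp add: M_def exp_add [symmetric] algebra_simps)
      also have "\<dots> \<le> D * exp (\<alpha> + (M\<^sup>2 / (2 * \<kappa>) - \<kappa> / 2 * s\<^sup>2))"
        using square D(1) by (intro mult_left_mono) auto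
      also have "\<dots> = norm (y - x) * (K * exp (- (\<kappa> / 2) * s\<^sup>2))"
        by (simp add: D_def K_def mult_exp_exp algebra_simps)
      finally show "\<bar>exp (a y + b y \<bullet> v - c y * (norm v)\<^sup>2) - exp (a x + b x \<bullet> v - c x * (norm v)\<^sup>2)\<bar> * (1 + norm v) ^ m
        \<le> norm (y - x) * (K * exp (- (\<kappa> / 2) * (norm v)\<^sup>2))"
        by (simp add: s_def)
    qed
  qed
  then show ?thesis
    using \<kappa> by (intro that[of "\<kappa> / 2" K]) auto
qed

section \<open>Collisions of a Maxwellian\<close>

lemma post_velocities_conserve:
  assumes "norm n = 1"
  shows "post_v v vs n + post_vs v vs n = v + vs"
    and "(norm (post_v v vs n))\<^sup>2 + (norm (post_vs v vs n))\<^sup>2 = (norm v)\<^sup>2 + (norm vs)\<^sup>2"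
proof -
  show "post_v v vs n + post_vs v vs n = v + vs"
    unfolding post_v_def post_vs_def by (simp add: vec_eq_iff)
  let ?c = "(v + vs) /\<^sub>R 2" and ?r = "(norm (v - vs) / 2) *\<^sub>R n"
  have parallelogram: "(norm (c + r))\<^sup>2 + (norm (c - r))\<^sup>2 = 2 * (norm c)\<^sup>2 + 2 * (norm r)\<^sup>2" for c r :: "real^3"
    by (simp add: power2_norm_eq_inner inner_simps inner_commute)
  have "(norm (?c + ?r))\<^sup>2 + (norm (?c - ?r))\<^sup>2 = 2 * (norm ?c)\<^sup>2 + 2 * (norm ?r)\<^sup>2"
    by (rule parallelogram)
  also have "(norm ?r)\<^sup>2 = (norm (v - vs))\<^sup>2 / 4"
    by (simp add: assms power_divide)
  also have "(norm ?c)\<^sup>2 = (norm (v + vs))\<^sup>2 / 4"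
    by (simp add: power_divide)
  also have "2 * ((norm (v + vs))\<^sup>2 / 4) + 2 * ((norm (v - vs))\<^sup>2 / 4) = (norm v)\<^sup>2 + (norm vs)\<^sup>2"
    using parallelogram[of v vs] by simp
  finally show "(norm (post_v v vs n))\<^sup>2 + (norm (post_vs v vs n))\<^sup>2 = (norm v)\<^sup>2 + (norm vs)\<^sup>2"
    by (simp add: post_v_def post_vs_def)
qed

text \<open>Detailed balance: the logarithm of a Maxwellian is a linear combination of \<open>1\<close>, \<open>v\<close> and
  \<open>(norm v)\<^sup>2\<close>, whose sums over the colliding pair are preserved by a collision.\<close>

lemma maxwellian_collision_invariant:
  assumes "norm n = 1"
  shows "maxwellian f (post_v v vs n) * maxwellian f (post_vs v vs n) = maxwellian f v * maxwellian f vs"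
proof -
  let ?w = "mean_velocity (moments f)" and ?T = "temperature (moments f)"
  let ?C = "mass_density (moments f) / (2 * pi * ?T) powr (3/2)"
  have prod: "maxwellian f a * maxwellian f b
      = ?C\<^sup>2 * exp (- ((norm (?w - a))\<^sup>2 + (norm (?w - b))\<^sup>2) / (2 * ?T))" for a b
    by (simp add: maxwellian_def Let_def power2_eq_square mult_exp_exp add_divide_distrib diff_divide_distrib)
  have sq: "(norm (?w - a))\<^sup>2 + (norm (?w - b))\<^sup>2
      = 2 * (norm ?w)\<^sup>2 - 2 * (?w \<bullet> (a + b)) + ((norm a)\<^sup>2 + (norm b)\<^sup>2)" for a b
    by (simp add: power2_norm_eq_inner inner_simps inner_commute)
  show ?thesis
    unfolding prod sq post_velocities_conserve[OF assms] ..
qed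

lemma finite_measure_sphere_measure: "finite_measure sphere_measure"
proof -
  have [measurable]: "(\<lambda>x::real^3. 3 * indicator (cball 0 1) x :: ennreal) \<in> borel_measurable borel"
    by (intro borel_measurable_times_ennreal borel_measurable_indicator) auto
  have "finite_measure (density lborel (\<lambda>x::real^3. 3 * indicator (cball 0 1) x))"
  proof
    have "emeasure (density lborel (\<lambda>x::real^3. 3 * indicator (cball 0 1) x)) UNIV
        = 3 * emeasure lborel (cball 0 1 :: (real^3) set)"
      by (subst emeasure_density) (simp_all add: nn_integral_cmult_indicator mult_indicator_subset)
    also have "\<dots> < \<infinity>"
      using emeasure_bounded_finite[of "cball 0 1 :: (real^3) set"]
      by (simp add: ennreal_mult_less_top)
    finally show "emeasure (density lborel (\<lambda>x::real^3. 3 * indicator (cball 0 1) x))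
        (space (density lborel (\<lambda>x::real^3. 3 * indicator (cball 0 1) x))) \<noteq> \<infinity>"
      by simp
  qed
  then show ?thesis
    unfolding sphere_measure_def by (rule finite_measure.finite_measure_distr) simp
qed

text \<open>The integral over directions is one over the whole ambient space, whereas collisions conserve energy
  only for unit vectors. Up to a null set the two agree: only the origin, where the radial projection
  is not a unit vector, has to be left out.\<close>

lemma AE_sphere_measure_norm: "AE n in sphere_measure. norm n = 1"
proof -
  have [measurable]: "(\<lambda>x::real^3. 3 * indicator (cball 0 1) x :: ennreal) \<in> borel_measurable borel"
    by (intro borel_measurable_times_ennreal borel_measurable_indicator) auto
  have "AE x in (density lborel (\<lambda>x::real^3. 3 * indicator (cball 0 1) x)). norm (x /\<^sub>R norm x) = 1"
    by (subst AE_density) (auto intro: AE_mp[OF AE_lborel_singleton[of 0]])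
  then show ?thesis
    unfolding sphere_measure_def by (subst AE_distr_iff) auto
qed

lemma Q_B_maxwellian: "Q_B B (maxwellian f) v = 0"
proof -
  interpret S: finite_measure sphere_measure by (rule finite_measure_sphere_measure)
  interpret pair_sigma_finite "lborel :: (real^3) measure" sphere_measure ..
  have [measurable_cong]: "sets sphere_measure = sets borel"
    by (simp add: sphere_measure_def)
  have "AE z in (lborel :: (real^3) measure) \<Otimes>\<^sub>M sphere_measure. norm (snd z) = 1"
    by (rule AE_pair_measure) (measurable, simp add: AE_sphere_measure_norm)
  then show ?thesis
    unfolding Q_B_def
    by (intro integral_eq_zero_AE) (auto elim!: eventually_mono simp: maxwellian_collision_invariant)
qed

lemma g_B_maxwellian:
  assumes "\<mu> \<noteq> 0" "f = maxwellian f"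
  shows "g_B B \<mu> f v = 0"
  using assms Q_B_maxwellian[of B f v] by (simp add: g_B_def P_B_def)

section \<open>Transport of a field of Maxwellians\<close>

lemma partial_bounded_linear:
  assumes "bounded_linear L" "h differentiable (at x)"
  shows "partial k (\<lambda>y. L (h y)) x = L (partial k h x)"
proof -
  have "((\<lambda>y. L (h y)) has_derivative (\<lambda>d. L (frechet_derivative h (at x) d))) (at x)"
    using assms by (intro bounded_linear.has_derivative[OF assms(1)]) (simp add: frechet_derivative_works)
  from frechet_derivative_at[OF this] show ?thesis
    unfolding partial_def by metis
qed

lemma differentiable_cong_open:
  assumes "open S" "x \<in> S" "\<And>y. y \<in> S \<Longrightarrow> f y = g y" "f differentiable (at x)"
  shows "g differentiable (at x)"
  using assms has_derivative_transform_within_open[of f _ x UNIV S g]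
  unfolding differentiable_def by blast

lemma differentiable_vec_componentwise:
  fixes f :: "'a::real_normed_vector \<Rightarrow> real^'n"
  assumes "\<And>i. (\<lambda>y. f y $ i) differentiable (at x)"
  shows "f differentiable (at x)"
proof -
  have eq: "f = (\<lambda>y. \<Sum>i\<in>UNIV. f y $ i *\<^sub>R axis i 1)"
    using basis_expansion[of "f _"] by (simp add: scalar_mult_eq_scaleR)
  show ?thesis
    by (subst eq) (intro differentiable_sum ballI differentiable_scaleR assms differentiable_const, simp)
qed

lemma differentiable_matrix_componentwise:
  fixes f :: "'a::real_normed_vector \<Rightarrow> real^'n^'m"
  assumes "\<And>i j. (\<lambda>y. f y $ i $ j) differentiable (at x)"
  shows "f differentiable (at x)"
proof -
  have eq: "f = (\<lambda>y. \<Sum>i\<in>UNIV. axis i (f y $ i))"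
    by (simp add: fun_eq_iff vec_eq_iff axis_def if_distrib cong: if_cong)
  have lin: "bounded_linear (axis i :: real^'n \<Rightarrow> real^'n^'m)" for i
    by (intro linear_conv_bounded_linear[THEN iffD1] linearI) (auto simp: axis_def vec_eq_iff)
  have "(\<lambda>y. axis i (f y $ i) :: real^'n^'m) differentiable (at x)" for i
    using differentiable_vec_componentwise[of "\<lambda>y. f y $ i" x] assms
      bounded_linear.has_derivative[OF lin] unfolding differentiable_def by blast
  then show ?thesis
    by (subst eq) (intro differentiable_sum ballI, simp_all)
qed

lemma differentiable_exp_at:
  fixes f :: "'a::real_normed_vector \<Rightarrow> real"
  shows "f differentiable (at x) \<Longrightarrow> (\<lambda>y. exp (f y)) differentiable (at x)"
  unfolding differentiable_def by (blast intro: has_derivative_exp)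

lemma differentiable_ln_at:
  fixes f :: "'a::real_normed_vector \<Rightarrow> real"
  shows "f differentiable (at x) \<Longrightarrow> f x > 0 \<Longrightarrow> (\<lambda>y. ln (f y)) differentiable (at x)"
  unfolding differentiable_def by (blast intro: has_derivative_ln)

lemma differentiable_norm_squared:
  fixes f :: "'a::real_normed_vector \<Rightarrow> 'b::real_inner"
  assumes "f differentiable (at x)"
  shows "(\<lambda>y. (norm (f y))\<^sup>2) differentiable (at x)"
  unfolding power2_norm_eq_inner using assms by (intro differentiable_inner)

text \<open>The velocity-independent part of the logarithm of a Gaussian. The logarithm is a quadratic polynomial
  in \<open>v\<close>, and its coefficients carry the same information as \<open>\<rho>\<close>, \<open>w\<close>, \<open>T\<close>.\<close>

definition gaussian_log_const :: "real \<Rightarrow> real^3 \<Rightarrow> real \<Rightarrow> real" where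
  "gaussian_log_const \<rho> w T = ln \<rho> - 3 / 2 * ln (2 * pi * T) - (norm w)\<^sup>2 / (2 * T)"

lemma gaussian_eq_exp_quadratic:
  assumes "\<rho> > 0" "T > 0"
  shows "gaussian \<rho> w T v
    = exp (gaussian_log_const \<rho> w T + (w /\<^sub>R T) \<bullet> v - 1 / (2 * T) * (norm v)\<^sup>2)"
proof -
  have sq: "(norm (w - v))\<^sup>2 = (norm w)\<^sup>2 - 2 * (w \<bullet> v) + (norm v)\<^sup>2"
    by (simp add: power2_norm_eq_inner inner_simps inner_commute)
  have split: "exp (l - p - q) = exp l / exp p * exp (- q)" for l p q :: real
    by (simp add: exp_diff exp_minus divide_inverse)
  have "gaussian \<rho> w T v = exp (ln \<rho> - 3 / 2 * ln (2 * pi * T) - (norm (w - v))\<^sup>2 / (2 * T))"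
    unfolding split gaussian_def powr_def using assms by simp
  also have "ln \<rho> - 3 / 2 * ln (2 * pi * T) - (norm (w - v))\<^sup>2 / (2 * T)
      = gaussian_log_const \<rho> w T + (w \<bullet> v) / T - 1 / (2 * T) * (norm v)\<^sup>2"
    unfolding sq gaussian_log_const_def by (simp add: add_divide_distrib diff_divide_distrib)
  also have "(w \<bullet> v) / T = (w /\<^sub>R T) \<bullet> v"
    by (simp add: divide_inverse mult.commute)
  finally show ?thesis .
qed

lemma gaussian_pos: "\<rho> > 0 \<Longrightarrow> T > 0 \<Longrightarrow> gaussian \<rho> w T v > 0"
  by (simp add: gaussian_eq_exp_quadratic)

text \<open>Differentiability of the hydrodynamic fields is recovered from that of the distribution at fixed
  velocities. A quadratic polynomial in \<open>v\<close> without mixed terms is determined by finitely many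
  values, here those at the origin and at plus and minus the unit vectors; thus the coefficients of the
  logarithm, and with them \<open>T\<close>, \<open>w\<close> and \<open>\<rho>\<close>, are differentiable expressions in finitely many
  functions \<open>\<lambda>y. ln (f y v)\<close>.\<close>

lemma gaussian_parameters_differentiable:
  fixes f :: "real^'d \<Rightarrow> vdist"
  assumes "open S" "x \<in> S"
    and f: "\<And>y. y \<in> S \<Longrightarrow> f y = gaussian (\<rho> y) (w y) (T y)"
    and pos: "\<And>y. y \<in> S \<Longrightarrow> \<rho> y > 0" "\<And>y. y \<in> S \<Longrightarrow> T y > 0"
    and diff: "\<And>v. (\<lambda>y. f y v) differentiable (at x)"
  shows "\<rho> differentiable (at x)" "w differentiable (at x)" "T differentiable (at x)"
proof -
  define l where "l v y = ln (f y v)" for v y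
  have fx: "f x v > 0" for v
    using assms by (simp add: gaussian_pos)
  have l_diff: "l v differentiable (at x)" for v
    unfolding l_def using diff fx by (intro differentiable_ln_at)
  have l: "l v y = gaussian_log_const (\<rho> y) (w y) (T y) + (w y /\<^sub>R T y) \<bullet> v - 1 / (2 * T y) * (norm v)\<^sup>2"
    if "y \<in> S" for v y
    using that by (simp add: l_def f pos gaussian_eq_exp_quadratic)
  \<comment> \<open>A second difference along one axis isolates the coefficient of the square, an odd difference the linear term.\<close>
  define c where "c y = l 0 y - (l (axis 1 1) y + l (- axis 1 1) y) / 2" for y
  have c: "c y = 1 / (2 * T y)" if "y \<in> S" for y
    using that by (simp add: c_def l diff_divide_distrib)
  have cx: "c x \<noteq> 0"
    using pos(2)[OF assms(2)] by (simp add: c[OF assms(2)])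
  have T: "1 / (2 * c y) = T y" if "y \<in> S" for y
    using that pos(2)[OF that] by (simp add: c)
  have "(\<lambda>y. 1 / (2 * c y)) differentiable (at x)"
    unfolding c_def using l_diff cx[unfolded c_def] by (intro derivative_intros) auto
  from differentiable_cong_open[OF assms(1,2) T this]
  show T_diff: "T differentiable (at x)" by simp
  have w: "T y * ((l (axis i 1) y - l (- axis i 1) y) / 2) = w y $ i" if "y \<in> S" for y i
    using that pos(2)[OF that] by (simp add: l inner_axis)
  have "(\<lambda>y. T y * ((l (axis i 1) y - l (- axis i 1) y) / 2)) differentiable (at x)" for i
    using l_diff T_diff by (intro derivative_intros) auto
  from differentiable_cong_open[OF assms(1,2) w this]
  show w_diff: "w differentiable (at x)" by (intro differentiable_vec_componentwise) simp
  have \<rho>: "exp (l 0 y + 3 / 2 * ln (2 * pi * T y) + (norm (w y))\<^sup>2 / (2 * T y)) = \<rho> y" if "y \<in> S" for y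
    using that pos by (simp add: l gaussian_log_const_def)
  have "(\<lambda>y. exp (l 0 y + 3 / 2 * ln (2 * pi * T y) + (norm (w y))\<^sup>2 / (2 * T y))) differentiable (at x)"
    using l_diff T_diff w_diff pos(2)[OF assms(2)]
    by (intro differentiable_exp_at differentiable_ln_at differentiable_norm_squared derivative_intros) auto
  from differentiable_cong_open[OF assms(1,2) \<rho> this]
  show "\<rho> differentiable (at x)" by simp
qed

lemma integrable_exp_neg_norm_squared:
  assumes "\<gamma> > 0"
  shows "integrable lborel (\<lambda>v::real^3. exp (- \<gamma> * (norm v)\<^sup>2))"
proof -
  let ?T = "1 / (2 * \<gamma>)"
  have "integrable lborel (gaussian ((2 * pi * ?T) powr (3/2)) 0 ?T)"
    using gaussian_mass[of ?T] assms integrable.intros by fastforce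
  moreover have "gaussian ((2 * pi * ?T) powr (3/2)) 0 ?T = (\<lambda>v. exp (- \<gamma> * (norm v)\<^sup>2))"
    using assms by (simp add: gaussian_def fun_eq_iff)
  ultimately show ?thesis by simp
qed

text \<open>The weights of the fluxes grow at most cubically, which selects the exponent \<open>3\<close> in the
  domination of the difference quotients.\<close>

lemma norm_flux_weight_le: "norm (v $ k *\<^sub>R invariants v) \<le> (1 + norm v) ^ 3"
proof -
  have "norm (invariants v) \<le> 1 + (norm v + (norm v)\<^sup>2 / 2)"
    unfolding invariants_def
    using norm_Pair_le[of "1::real" "(v, (norm v)\<^sup>2 / 2)"] norm_Pair_le[of v "(norm v)\<^sup>2 / 2"] by simp
  also have "\<dots> \<le> (1 + norm v)\<^sup>2"
    by (simp add: power2_eq_square algebra_simps)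
  finally have inv: "norm (invariants v) \<le> (1 + norm v)\<^sup>2" .
  have "\<bar>v $ k\<bar> \<le> 1 + norm v"
    using component_le_norm_cart[of v k] by simp
  then have "\<bar>v $ k\<bar> * norm (invariants v) \<le> (1 + norm v) * (1 + norm v)\<^sup>2"
    using inv by (intro mult_mono) auto
  then show ?thesis
    by (simp add: power3_eq_cube power2_eq_square mult.assoc)
qed

text \<open>The Euler flux is a polynomial in density, velocity and temperature; the energy is so by the
  definition of the temperature, as long as the density is positive.\<close>

lemma euler_flux_differentiable:
  fixes u :: "'a::real_normed_vector \<Rightarrow> state"
  assumes "open S" "x \<in> S" "\<And>y. y \<in> S \<Longrightarrow> mass_density (u y) > 0"
    and \<rho>: "(\<lambda>y. mass_density (u y)) differentiable (at x)"
    and w: "(\<lambda>y. mean_velocity (u y)) differentiable (at x)"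
    and T: "(\<lambda>y. temperature (u y)) differentiable (at x)"
  shows "(\<lambda>y. euler_flux (u y)) differentiable (at x)"
proof -
  have p: "(\<lambda>y. pressure (u y)) differentiable (at x)"
    unfolding pressure_def using \<rho> T by (intro differentiable_mult)
  have wi: "(\<lambda>y. mean_velocity (u y) $ i) differentiable (at x)" for i
    using bounded_linear.has_derivative[OF bounded_linear_vec_nth[of i]] w
    unfolding differentiable_def by blast
  have eq: "(3 * mass_density (u y) * temperature (u y)
      + mass_density (u y) * (norm (mean_velocity (u y)))\<^sup>2) / 2 = energy (u y)" if "y \<in> S" for y
    using arg_cong[OF state_eq_hydrodynamic[OF assms(3)[OF that]], of energy] by (simp add: energy_def)
  have "(\<lambda>y. (3 * mass_density (u y) * temperature (u y)
      + mass_density (u y) * (norm (mean_velocity (u y)))\<^sup>2) / 2) differentiable (at x)"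
    using \<rho> w T by (intro derivative_intros differentiable_norm_squared) auto
  then have E: "(\<lambda>y. energy (u y)) differentiable (at x)"
    using differentiable_cong_open[OF assms(1,2) eq] by simp
  have M: "(\<lambda>y. (\<chi> i j. mass_density (u y) * mean_velocity (u y) $ i * mean_velocity (u y) $ j)
      + mat (pressure (u y)) :: real^3^3) differentiable (at x)"
  proof (rule differentiable_matrix_componentwise)
    fix i j :: 3
    have "(\<lambda>y. mass_density (u y) * mean_velocity (u y) $ i * mean_velocity (u y) $ j
        + (if i = j then pressure (u y) else 0)) differentiable (at x)"
      using \<rho> wi p by (cases "i = j") (auto intro!: derivative_intros)
    then show "(\<lambda>y. ((\<chi> i j. mass_density (u y) * mean_velocity (u y) $ i * mean_velocity (u y) $ j)
        + mat (pressure (u y)) :: real^3^3) $ i $ j) differentiable (at x)"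
      by (simp add: mat_def)
  qed
  show ?thesis
    unfolding euler_flux_def
    by (intro differentiable_Pair M) (intro differentiable_add differentiable_scaleR \<rho> w E p)+
qed

lemma bounded_linear_flux_column: "bounded_linear (flux_column k)"
  by (intro linear_conv_bounded_linear[THEN iffD1] linearI) (auto simp: flux_column_def vec_eq_iff)

lemma flux_div_eq_sum_partial:
  assumes "\<Phi> differentiable (at x)"
  shows "flux_div \<iota> \<Phi> x = (\<Sum>k\<in>UNIV. partial k (\<lambda>y. flux_column (\<iota> k) (\<Phi> y)) x)"
proof -
  have lin: "bounded_linear (\<lambda>a::flux. fst a $ k)" "bounded_linear (\<lambda>a::flux. fst (snd a) $ i $ k)"
    "bounded_linear (\<lambda>a::flux. snd (snd a) $ k)" for i k
    by (intro linear_conv_bounded_linear[THEN iffD1] linearI; simp)+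
  show ?thesis
    unfolding flux_div_def partial_bounded_linear[OF lin(1) assms] partial_bounded_linear[OF lin(2) assms]
      partial_bounded_linear[OF lin(3) assms] partial_bounded_linear[OF bounded_linear_flux_column assms]
    by (simp add: flux_column_def prod_eq_iff vec_eq_iff fst_sum snd_sum)
qed

text \<open>The moments of the transport term of a field of Maxwellians form the divergence of the Euler flux.
  By \<open>maxwellian_flux\<close> this is the exchange of the space derivative with the velocity integral.
  The exchange is justified by the Gaussian form of \<open>f\<close>: its parameters are differentiable by
  \<open>gaussian_parameters_differentiable\<close>, and its difference quotients are dominated by
  \<open>exp_quadratic_Lipschitz\<close>.\<close>

lemma transport_moments_of_local_equilibrium:
  fixes f :: "real^'d \<Rightarrow> vdist"
  assumes "open \<Omega>" "x \<in> \<Omega>"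
    and reg: "regular_dist \<Omega> f"
    and eq: "\<And>y. y \<in> \<Omega> \<Longrightarrow> f y = maxwellian (f y)"
  shows "(\<lambda>y. euler_flux (moments (f y))) differentiable (at x)"
    and "moments (transport \<iota> f x) = flux_div \<iota> (\<lambda>y. euler_flux (moments (f y))) x"
proof -
  define \<rho> w T where "\<rho> y = mass_density (moments (f y))" and "w y = mean_velocity (moments (f y))"
    and "T y = temperature (moments (f y))" for y
  have f: "f y = gaussian (\<rho> y) (w y) (T y)" if "y \<in> \<Omega>" for y
    using eq[OF that] unfolding \<rho>_def w_def T_def maxwellian_eq_gaussian .
  have pos: "\<rho> y > 0" "T y > 0" if "y \<in> \<Omega>" for y
    using reg that by (auto simp: regular_dist_def \<rho>_def T_def)
  have f_diff: "(\<lambda>y. f y v) differentiable (at x)" for v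
    using reg assms(2) by (auto simp: regular_dist_def)
  note par = gaussian_parameters_differentiable[OF assms(1,2) f pos f_diff]
  show flux_diff: "(\<lambda>y. euler_flux (moments (f y))) differentiable (at x)"
    by (rule euler_flux_differentiable[OF assms(1,2)])
      (use par pos in \<open>auto simp: \<rho>_def [abs_def] w_def [abs_def] T_def [abs_def]\<close>)
  define a b c where "a y = gaussian_log_const (\<rho> y) (w y) (T y)" and "b y = w y /\<^sub>R T y"
    and "c y = 1 / (2 * T y)" for y
  have fexp: "f y v = exp (a y + b y \<bullet> v - c y * (norm v)\<^sup>2)" if "y \<in> \<Omega>" for y v
    using gaussian_eq_exp_quadratic[OF pos[OF that]] that by (simp add: f a_def b_def c_def)
  have "a differentiable (at x)" "b differentiable (at x)" "c differentiable (at x)" "c x > 0"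
    unfolding a_def b_def c_def gaussian_log_const_def using par pos[OF assms(2)]
    by (auto intro!: derivative_intros differentiable_ln_at differentiable_norm_squared)
  then obtain K \<gamma> where \<gamma>: "\<gamma> > 0" and Lip: "\<forall>\<^sub>F y in nhds x. \<forall>v.
      \<bar>exp (a y + b y \<bullet> v - c y * (norm v)\<^sup>2) - exp (a x + b x \<bullet> v - c x * (norm v)\<^sup>2)\<bar> * (1 + norm v) ^ 3
        \<le> norm (y - x) * (K * exp (- \<gamma> * (norm v)\<^sup>2))"
    by (rule exp_quadratic_Lipschitz)
  have in_\<Omega>: "\<forall>\<^sub>F y in nhds x. y \<in> \<Omega>"
    using assms(1,2) by (rule eventually_nhds_in_open)
  have column: "has_bochner_integral lborel (\<lambda>v. partial k (\<lambda>y. f y v *\<^sub>R (v $ j *\<^sub>R invariants v)) x)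
      (partial k (\<lambda>y. flux_column j (euler_flux (moments (f y)))) x)" for k :: 'd and j
  proof (rule partial_has_bochner_integral)
    show "(\<lambda>y. f y v *\<^sub>R (v $ j *\<^sub>R invariants v)) differentiable (at x)" for v
      using f_diff by (intro differentiable_scaleR differentiable_const)
    show "\<forall>\<^sub>F y in nhds x. has_bochner_integral lborel (\<lambda>v. f y v *\<^sub>R (v $ j *\<^sub>R invariants v))
        (flux_column j (euler_flux (moments (f y))))"
      using in_\<Omega>
    proof eventually_elim
      case (elim y)
      then show ?case
        using maxwellian_flux[of "f y" j] pos[OF elim] eq[OF elim] by (simp add: \<rho>_def T_def)
    qed
    show "(\<lambda>y. flux_column j (euler_flux (moments (f y)))) differentiable (at x)"
      using bounded_linear.has_derivative[OF bounded_linear_flux_column] flux_diff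
      unfolding differentiable_def by blast
    show "\<forall>\<^sub>F y in nhds x. \<forall>v. norm (f y v *\<^sub>R (v $ j *\<^sub>R invariants v) - f x v *\<^sub>R (v $ j *\<^sub>R invariants v))
        \<le> norm (y - x) * (K * exp (- \<gamma> * (norm v)\<^sup>2))"
      using in_\<Omega> Lip
    proof eventually_elim
      case (elim y)
      show ?case
      proof
        fix v
        have "norm (f y v *\<^sub>R (v $ j *\<^sub>R invariants v) - f x v *\<^sub>R (v $ j *\<^sub>R invariants v))
            = \<bar>f y v - f x v\<bar> * norm (v $ j *\<^sub>R invariants v)"
          by (metis norm_scaleR real_norm_def scaleR_left_diff_distrib)
        also have "\<dots> \<le> \<bar>f y v - f x v\<bar> * (1 + norm v) ^ 3"
          by (intro mult_left_mono norm_flux_weight_le) simp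
        also have "\<dots> \<le> norm (y - x) * (K * exp (- \<gamma> * (norm v)\<^sup>2))"
          using elim assms(2) by (simp add: fexp)
        finally show "norm (f y v *\<^sub>R (v $ j *\<^sub>R invariants v) - f x v *\<^sub>R (v $ j *\<^sub>R invariants v))
            \<le> norm (y - x) * (K * exp (- \<gamma> * (norm v)\<^sup>2))" .
      qed
    qed
    show "integrable lborel (\<lambda>v::real^3. K * exp (- \<gamma> * (norm v)\<^sup>2))"
      using integrable_exp_neg_norm_squared[OF \<gamma>] by (rule integrable_mult_right)
  qed
  have weighted: "partial k (\<lambda>y. f y v *\<^sub>R (v $ j *\<^sub>R invariants v)) x
      = partial k (\<lambda>y. f y v) x *\<^sub>R (v $ j *\<^sub>R invariants v)" for k :: 'd and j v
    by (rule partial_bounded_linear[OF bounded_linear_scaleR_left f_diff])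
  have "transport \<iota> f x v *\<^sub>R invariants v
      = (\<Sum>k\<in>UNIV. partial k (\<lambda>y. f y v *\<^sub>R (v $ \<iota> k *\<^sub>R invariants v)) x)" for v
    unfolding weighted by (simp add: transport_def scaleR_sum_left mult.commute)
  then have "has_bochner_integral lborel (\<lambda>v. transport \<iota> f x v *\<^sub>R invariants v)
      (\<Sum>k\<in>UNIV. partial k (\<lambda>y. flux_column (\<iota> k) (euler_flux (moments (f y)))) x)"
    using column by (simp add: has_bochner_integral_sum)
  then show "moments (transport \<iota> f x) = flux_div \<iota> (\<lambda>y. euler_flux (moments (f y))) x"
    unfolding moments_def [of "transport \<iota> f x"]
    by (simp add: flux_div_eq_sum_partial[OF flux_diff] has_bochner_integral_integral_eq)
qed

section \<open>The stages of the scheme and their limit\<close>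

lemma finite_moments_iff_has_bochner_integral:
  "finite_moments f \<longleftrightarrow> has_bochner_integral lborel (\<lambda>v. f v *\<^sub>R invariants v) (moments f)"
  by (simp add: finite_moments_def moments_def has_bochner_integral_iff)

text \<open>The stiff explicit term contributes nothing to the moments: collisions conserve the invariants, and a
  distribution and its Maxwellian have the same moments.\<close>

lemma g_B_moments:
  assumes "\<mu> \<noteq> 0" "finite_moments f" "mass_density (moments f) > 0" "temperature (moments f) > 0"
    and "conserves_invariants B f"
  shows "has_bochner_integral lborel (\<lambda>v. g_B B \<mu> f v *\<^sub>R invariants v) 0"
proof -
  have "has_bochner_integral lborel (\<lambda>v. (1 / \<mu>) *\<^sub>R (Q_B B f v *\<^sub>R invariants v) + f v *\<^sub>R invariants v
      - maxwellian f v *\<^sub>R invariants v) ((1 / \<mu>) *\<^sub>R moments (Q_B B f) + moments f - moments f)"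
    using assms maxwellian_moments
    by (intro has_bochner_integral_add has_bochner_integral_diff has_bochner_integral_scaleR_right)
      (auto simp: conserves_invariants_def finite_moments_iff_has_bochner_integral)
  moreover have "(1 / \<mu>) *\<^sub>R (Q_B B f v *\<^sub>R invariants v) + f v *\<^sub>R invariants v
      - maxwellian f v *\<^sub>R invariants v = g_B B \<mu> f v *\<^sub>R invariants v" for v
    using assms(1) by (simp add: g_B_def P_B_def add_divide_distrib scaleR_left_distrib scaleR_left_diff_distrib)
  ultimately show ?thesis
    using assms(5) by (simp add: conserves_invariants_def)
qed

text \<open>All terms with a factor \<open>1 / \<epsilon>\<close> have vanishing moments, so the moment equations do not depend on
  \<open>\<epsilon>\<close> explicitly and are already those of the explicit tableau, with the kinetic transport term in
  place of the flux divergence.\<close>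

lemma imex_stage_moments:
  assumes "\<mu> \<noteq> 0" "x \<in> \<Omega>" "finite_moments (fn x)"
    and step: "imex_step \<iota> \<Omega> B \<mu> \<epsilon> \<Delta>t At wt A w fn F fn1"
    and reg: "\<And>j. regular_dist \<Omega> (F j)"
    and cons: "\<And>j. conserves_invariants B (F j x)"
    and tr: "\<And>j. finite_moments (transport \<iota> (F j) x)"
  shows "moments (F i x) = moments (fn x)
    - \<Delta>t *\<^sub>R (\<Sum>j | j < i. At $ i $ j *\<^sub>R moments (transport \<iota> (F j) x))"
proof -
  have F: "finite_moments (F j x)" "mass_density (moments (F j x)) > 0" "temperature (moments (F j x)) > 0" for j
    using reg assms(2) by (auto simp: regular_dist_def)
  note g = g_B_moments[OF assms(1) F cons] and M = maxwellian_moments[OF F(2,3)]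
  have "has_bochner_integral lborel
     (\<lambda>v. fn x v *\<^sub>R invariants v
        + \<Delta>t *\<^sub>R (\<Sum>j | j < i. At $ i $ j *\<^sub>R ((\<mu> / \<epsilon>) *\<^sub>R (g_B B \<mu> (F j x) v *\<^sub>R invariants v)
            - transport \<iota> (F j) x v *\<^sub>R invariants v))
        + \<Delta>t *\<^sub>R (\<Sum>j | j \<le> i. (A $ i $ j * (\<mu> / \<epsilon>)) *\<^sub>R (maxwellian (F j x) v *\<^sub>R invariants v
            - F j x v *\<^sub>R invariants v)))
     (moments (fn x)
        + \<Delta>t *\<^sub>R (\<Sum>j | j < i. At $ i $ j *\<^sub>R ((\<mu> / \<epsilon>) *\<^sub>R 0 - moments (transport \<iota> (F j) x)))
        + \<Delta>t *\<^sub>R (\<Sum>j | j \<le> i. (A $ i $ j * (\<mu> / \<epsilon>)) *\<^sub>R (moments (F j x) - moments (F j x))))"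
    using assms(3) tr F(1) unfolding finite_moments_iff_has_bochner_integral
    by (intro has_bochner_integral_add has_bochner_integral_diff has_bochner_integral_scaleR_right
        has_bochner_integral_sum g M)
  moreover have "fn x v *\<^sub>R invariants v
        + \<Delta>t *\<^sub>R (\<Sum>j | j < i. At $ i $ j *\<^sub>R ((\<mu> / \<epsilon>) *\<^sub>R (g_B B \<mu> (F j x) v *\<^sub>R invariants v)
            - transport \<iota> (F j) x v *\<^sub>R invariants v))
        + \<Delta>t *\<^sub>R (\<Sum>j | j \<le> i. (A $ i $ j * (\<mu> / \<epsilon>)) *\<^sub>R (maxwellian (F j x) v *\<^sub>R invariants v
            - F j x v *\<^sub>R invariants v)) = F i x v *\<^sub>R invariants v" for v
  proof -
    have "F i x v = fn x v
          + \<Delta>t * (\<Sum>j | j < i. At $ i $ j * (\<mu> / \<epsilon> * g_B B \<mu> (F j x) v - transport \<iota> (F j) x v))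
          + \<Delta>t * (\<Sum>j | j \<le> i. A $ i $ j * (\<mu> / \<epsilon>) * (maxwellian (F j x) v - F j x v))"
      using step assms(2) unfolding imex_step_def by blast
    then show ?thesis
      by (simp only: scaleR_left_distrib scaleR_scaleR [symmetric] scaleR_sum_left scaleR_left_diff_distrib)
  qed
  ultimately have "has_bochner_integral lborel (\<lambda>v. F i x v *\<^sub>R invariants v)
      (moments (fn x) + \<Delta>t *\<^sub>R (\<Sum>j | j < i. At $ i $ j *\<^sub>R ((\<mu> / \<epsilon>) *\<^sub>R 0 - moments (transport \<iota> (F j) x)))
        + \<Delta>t *\<^sub>R (\<Sum>j | j \<le> i. (A $ i $ j * (\<mu> / \<epsilon>)) *\<^sub>R (moments (F j x) - moments (F j x))))"
    by simp
  from has_bochner_integral_integral_eq[OF this] show ?thesis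
    by (simp add: moments_def[of "F i x"] sum_negf)
qed

text \<open>Global stiff accuracy makes the update coincide with the last stage, so that it inherits the
  limit of that stage.\<close>

lemma imex_last_stage:
  fixes At A :: "real^('s::{finite,wellorder})^('s::{finite,wellorder})"
  assumes "imex_step \<iota> \<Omega> B \<mu> \<epsilon> \<Delta>t At wt A w fn F fn1"
    and "\<And>i j. i \<le> j \<Longrightarrow> At $ i $ j = 0"
    and "\<And>i. w $ i = A $ Max UNIV $ i" "\<And>i. wt $ i = At $ Max UNIV $ i"
    and "x \<in> \<Omega>"
  shows "fn1 x = F (Max UNIV) x"
proof
  fix v
  let ?N = "Max UNIV :: 's"
  have le: "{j. j \<le> ?N} = UNIV" by auto
  have lt: "(\<Sum>j | j < ?N. At $ ?N $ j * h j) = (\<Sum>j\<in>UNIV. At $ ?N $ j * h j)" for h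
    using assms(2) by (intro sum.mono_neutral_left) (auto simp: not_less)
  show "fn1 x v = F ?N x v"
    using assms(1,5) unfolding imex_step_def assms(3,4) by (simp add: le lt)
qed

lemma lower_triangular_invertible_diagonal:
  fixes A :: "real^('s::{finite,wellorder})^('s::{finite,wellorder})"
  assumes "\<And>i j. i < j \<Longrightarrow> A $ i $ j = 0" "det A \<noteq> 0"
  shows "A $ i $ i \<noteq> 0"
  using assms det_lowerdiagonal[of A] by simp

text \<open>Multiplied by \<open>\<epsilon>\<close>, stage \<open>i\<close> leaves in the limit a balance between \<open>g\<close> at the earlier stages and
  the defects \<open>M[F] - F\<close> at the stages up to \<open>i\<close>. If the earlier stages are Maxwellian, their defects
  vanish, and so does \<open>g\<close> there by \<open>g_B_maxwellian\<close>. Only \<open>A $ i $ i\<close> times the defect of stage \<open>i\<close>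
  is left, and the diagonal of an invertible triangular matrix has no zero.\<close>

lemma imex_stages_local_equilibrium:
  fixes At A :: "real^('s::{finite,wellorder})^('s::{finite,wellorder})"
  assumes "\<mu> > 0" "\<Delta>t \<noteq> 0" "x \<in> \<Omega>"
    and tri: "\<And>i j. i < j \<Longrightarrow> A $ i $ j = 0" "det A \<noteq> 0"
    and scheme: "\<forall>\<^sub>F \<epsilon> in at_right 0. imex_step \<iota> \<Omega> B \<mu> \<epsilon> \<Delta>t At wt A w fn (F \<epsilon>) (fnext \<epsilon>)"
    and limit: "\<And>i. kinetic_limit \<iota> \<Omega> B \<mu> (\<lambda>\<epsilon>. F \<epsilon> i) (F0 i)"
  shows "F0 i x = maxwellian (F0 i x)"
proof -
  have tF: "((\<lambda>\<epsilon>. F \<epsilon> i x v) \<longlongrightarrow> F0 i x v) (at_right 0)"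
    and tM: "((\<lambda>\<epsilon>. maxwellian (F \<epsilon> i x) v) \<longlongrightarrow> maxwellian (F0 i x) v) (at_right 0)"
    and tg: "((\<lambda>\<epsilon>. g_B B \<mu> (F \<epsilon> i x) v) \<longlongrightarrow> g_B B \<mu> (F0 i x) v) (at_right 0)"
    and tt: "((\<lambda>\<epsilon>. transport \<iota> (F \<epsilon> i) x v) \<longlongrightarrow> transport \<iota> (F0 i) x v) (at_right 0)" for i v
    using limit[of i] assms(3) unfolding kinetic_limit_def converges_with_moments_def by auto
  have t\<epsilon>: "((\<lambda>\<epsilon>. \<epsilon>) \<longlongrightarrow> 0) (at_right (0::real))"
    by (rule tendsto_ident_at)
  have balance: "(\<Sum>j | j < i. At $ i $ j * g_B B \<mu> (F0 j x) v)
      + (\<Sum>j | j \<le> i. A $ i $ j * (maxwellian (F0 j x) v - F0 j x v)) = 0" for i v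
  proof -
    \<comment> \<open>The right-hand side of stage \<open>i\<close> after multiplication by \<open>\<epsilon>\<close>; only the transport terms keep a factor \<open>\<epsilon>\<close>.\<close>
    let ?R = "\<lambda>\<epsilon>. \<Delta>t * (\<Sum>j | j < i. At $ i $ j * (\<mu> * g_B B \<mu> (F \<epsilon> j x) v - \<epsilon> * transport \<iota> (F \<epsilon> j) x v))
          + \<Delta>t * (\<Sum>j | j \<le> i. A $ i $ j * \<mu> * (maxwellian (F \<epsilon> j x) v - F \<epsilon> j x v))"
    have "\<forall>\<^sub>F \<epsilon> in at_right (0::real). \<epsilon> > 0"
      by (simp add: eventually_at_right_less)
    with scheme have "\<forall>\<^sub>F \<epsilon> in at_right 0. \<epsilon> * (F \<epsilon> i x v - fn x v) = ?R \<epsilon>"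
    proof eventually_elim
      case (elim \<epsilon>)
      then have *: "F \<epsilon> i x v = fn x v
          + \<Delta>t * (\<Sum>j | j < i. At $ i $ j * (\<mu> / \<epsilon> * g_B B \<mu> (F \<epsilon> j x) v - transport \<iota> (F \<epsilon> j) x v))
          + \<Delta>t * (\<Sum>j | j \<le> i. A $ i $ j * (\<mu> / \<epsilon>) * (maxwellian (F \<epsilon> j x) v - F \<epsilon> j x v))"
        using assms(3) unfolding imex_step_def by blast
      have "\<epsilon> * (F \<epsilon> i x v - fn x v) =
          \<Delta>t * (\<Sum>j | j < i. \<epsilon> * (At $ i $ j * (\<mu> / \<epsilon> * g_B B \<mu> (F \<epsilon> j x) v - transport \<iota> (F \<epsilon> j) x v)))
          + \<Delta>t * (\<Sum>j | j \<le> i. \<epsilon> * (A $ i $ j * (\<mu> / \<epsilon>) * (maxwellian (F \<epsilon> j x) v - F \<epsilon> j x v)))"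
        unfolding * sum_distrib_left [symmetric] by (simp add: algebra_simps)
      also have "\<dots> = ?R \<epsilon>"
        using elim(2) by (intro arg_cong2[of _ _ _ _ "(+)"] arg_cong[of _ _ "(*) \<Delta>t"] sum.cong refl)
          (simp_all add: field_simps)
      finally show ?case .
    qed
    moreover have "((\<lambda>\<epsilon>. \<epsilon> * (F \<epsilon> i x v - fn x v)) \<longlongrightarrow> 0 * (F0 i x v - fn x v)) (at_right 0)"
      by (intro tendsto_intros tF)
    ultimately have "(?R \<longlongrightarrow> 0) (at_right 0)"
      by (simp add: tendsto_cong)
    moreover have "(?R \<longlongrightarrow> \<Delta>t * (\<Sum>j | j < i. At $ i $ j * (\<mu> * g_B B \<mu> (F0 j x) v - 0 * transport \<iota> (F0 j) x v))
          + \<Delta>t * (\<Sum>j | j \<le> i. A $ i $ j * \<mu> * (maxwellian (F0 j x) v - F0 j x v))) (at_right 0)"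
      by (intro tendsto_intros tF tM tg tt)
    ultimately have "\<Delta>t * (\<Sum>j | j < i. At $ i $ j * (\<mu> * g_B B \<mu> (F0 j x) v - 0 * transport \<iota> (F0 j) x v))
          + \<Delta>t * (\<Sum>j | j \<le> i. A $ i $ j * \<mu> * (maxwellian (F0 j x) v - F0 j x v)) = 0"
      using tendsto_unique[OF trivial_limit_at_right_real] by blast
    then have "\<Delta>t * \<mu> * ((\<Sum>j | j < i. At $ i $ j * g_B B \<mu> (F0 j x) v)
      + (\<Sum>j | j \<le> i. A $ i $ j * (maxwellian (F0 j x) v - F0 j x v))) = 0"
      by (simp add: sum_distrib_left algebra_simps)
    then show ?thesis
      using assms(1,2) by simp
  qed
  show ?thesis
  proof (induction i rule: less_induct)
    case (less i)
    show ?case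
    proof
      fix v
      have split: "{j. j \<le> i} = insert i {j. j < i}" by auto
      have "g_B B \<mu> (F0 j x) v = 0" "maxwellian (F0 j x) v - F0 j x v = 0" if "j < i" for j
        using g_B_maxwellian[OF _ less[OF that]] fun_cong[OF less[OF that], of v] assms(1) by auto
      then have "A $ i $ i * (maxwellian (F0 i x) v - F0 i x v) = 0"
        using balance[of i v] unfolding split by simp
      then show "F0 i x v = maxwellian (F0 i x) v"
        using lower_triangular_invertible_diagonal[OF tri] by simp
    qed
  qed
qed

lemma converges_with_moments_transform:
  assumes conv: "converges_with_moments \<Omega> h h0"
    and eq: "\<forall>\<^sub>F \<epsilon> in at_right 0. \<forall>x\<in>\<Omega>. h \<epsilon> x = h' \<epsilon> x"
  shows "converges_with_moments \<Omega> h' h0"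
  unfolding converges_with_moments_def
proof (intro ballI conjI allI)
  fix x assume x: "x \<in> \<Omega>"
  have eq_x: "\<forall>\<^sub>F \<epsilon> in at_right 0. h \<epsilon> x = h' \<epsilon> x"
    using eq by eventually_elim (use x in blast)
  have pointwise: "((\<lambda>\<epsilon>. h \<epsilon> x v) \<longlongrightarrow> h0 x v) (at_right 0)" for v
    using conv x unfolding converges_with_moments_def by blast
  have fin: "\<forall>\<^sub>F \<epsilon> in at_right 0. finite_moments (h \<epsilon> x)"
    using conv x unfolding converges_with_moments_def by blast
  have mom: "((\<lambda>\<epsilon>. moments (h \<epsilon> x)) \<longlongrightarrow> moments (h0 x)) (at_right 0)"
    using conv x unfolding converges_with_moments_def by blast
  show "finite_moments (h0 x)"
    using conv x unfolding converges_with_moments_def by blast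
  show "\<forall>\<^sub>F \<epsilon> in at_right 0. finite_moments (h' \<epsilon> x)"
    using fin eq_x by eventually_elim simp
  show "((\<lambda>\<epsilon>. moments (h' \<epsilon> x)) \<longlongrightarrow> moments (h0 x)) (at_right 0)"
    by (rule Lim_transform_eventually[OF mom]) (use eq_x in eventually_elim, simp)
  show "((\<lambda>\<epsilon>. h' \<epsilon> x v) \<longlongrightarrow> h0 x v) (at_right 0)" for v
    by (rule Lim_transform_eventually[OF pointwise]) (use eq_x in eventually_elim, simp)
qed

theorem theorem1:
  fixes \<iota> :: "'d::finite \<Rightarrow> 3"
    and \<Omega> :: "(real^'d) set"
    and B :: "real \<Rightarrow> real^3 \<Rightarrow> real"
    and \<mu> \<Delta>t :: real
    and At A :: "real^('s::{finite,wellorder})^('s::{finite,wellorder})"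
    and wt w :: "real^('s::{finite,wellorder})"
    and fn :: "real^'d \<Rightarrow> vdist"
    and F :: "real \<Rightarrow> ('s::{finite,wellorder}) \<Rightarrow> real^'d \<Rightarrow> vdist"
    and fnext :: "real \<Rightarrow> real^'d \<Rightarrow> vdist"
    and F0 :: "('s::{finite,wellorder}) \<Rightarrow> real^'d \<Rightarrow> vdist"
  assumes "inj \<iota>" and "open \<Omega>"
    and "\<mu> > 0" and "\<Delta>t > 0"
    and kernel_nonneg: "\<And>r n. r \<ge> 0 \<Longrightarrow> norm n = 1 \<Longrightarrow> B r n \<ge> 0"
    and explicit: "\<And>i j. i \<le> j \<Longrightarrow> At $ i $ j = 0"
    and diagonally_implicit: "\<And>i j. i < j \<Longrightarrow> A $ i $ j = 0"
    and invertible: "det A \<noteq> 0"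
    and globally_stiffly_accurate: "\<And>i. w $ i = A $ Max UNIV $ i" "\<And>i. wt $ i = At $ Max UNIV $ i"
    and initial: "\<And>x. x \<in> \<Omega> \<Longrightarrow> finite_moments (fn x)"
    and scheme: "\<forall>\<^sub>F \<epsilon> in at_right 0. imex_step \<iota> \<Omega> B \<mu> \<epsilon> \<Delta>t At wt A w fn (F \<epsilon>) (fnext \<epsilon>)"
    and regular: "\<forall>\<^sub>F \<epsilon> in at_right 0. \<forall>i. regular_dist \<Omega> (F \<epsilon> i)"
    and conservation: "\<forall>\<^sub>F \<epsilon> in at_right 0. \<forall>i. \<forall>x\<in>\<Omega>. conserves_invariants B (F \<epsilon> i x)"
    and P_nonneg: "\<forall>\<^sub>F \<epsilon> in at_right 0. \<forall>i. \<forall>x\<in>\<Omega>. \<forall>v. P_B B \<mu> (F \<epsilon> i x) v \<ge> 0"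
    and limit_regular: "\<And>i. regular_dist \<Omega> (F0 i)"
    and limit: "\<And>i. kinetic_limit \<iota> \<Omega> B \<mu> (\<lambda>\<epsilon>. F \<epsilon> i) (F0 i)"
  shows "\<exists>fnext0.
     converges_with_moments \<Omega> fnext fnext0 \<and>
     explicit_rk_euler \<iota> \<Omega> \<Delta>t At wt
       (\<lambda>x. moments (fn x)) (\<lambda>i x. moments (F0 i x)) (\<lambda>x. moments (fnext0 x))"
proof (intro exI conjI)
  let ?N = "Max UNIV :: 's"
  have last: "\<forall>\<^sub>F \<epsilon> in at_right 0. \<forall>x\<in>\<Omega>. F \<epsilon> ?N x = fnext \<epsilon> x"
    using scheme
    by eventually_elim (auto dest: imex_last_stage[OF _ explicit globally_stiffly_accurate])
  have "converges_with_moments \<Omega> (\<lambda>\<epsilon>. F \<epsilon> ?N) (F0 ?N)"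
    using limit[of ?N] by (simp add: kinetic_limit_def)
  then show "converges_with_moments \<Omega> fnext (F0 ?N)"
    using last by (rule converges_with_moments_transform)
  have equilibrium: "F0 i x = maxwellian (F0 i x)" if "x \<in> \<Omega>" for i x
    using imex_stages_local_equilibrium[OF \<open>\<mu> > 0\<close> _ that diagonally_implicit invertible scheme limit]
      \<open>\<Delta>t > 0\<close> by simp
  note euler = transport_moments_of_local_equilibrium[OF \<open>open \<Omega>\<close> _ limit_regular equilibrium]
  have stage: "moments (F0 i x) = moments (fn x)
      - \<Delta>t *\<^sub>R (\<Sum>j | j < i. At $ i $ j *\<^sub>R flux_div \<iota> (\<lambda>y. euler_flux (moments (F0 j y))) x)"
    if "x \<in> \<Omega>" for i x
  proof -
    have tr: "\<forall>\<^sub>F \<epsilon> in at_right 0. finite_moments (transport \<iota> (F \<epsilon> j) x)"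
      and tr_lim: "((\<lambda>\<epsilon>. moments (transport \<iota> (F \<epsilon> j) x)) \<longlongrightarrow> moments (transport \<iota> (F0 j) x)) (at_right 0)"
      and F_lim: "((\<lambda>\<epsilon>. moments (F \<epsilon> j x)) \<longlongrightarrow> moments (F0 j x)) (at_right 0)" for j
      using limit[of j] that by (auto simp: kinetic_limit_def converges_with_moments_def)
    have "\<forall>\<^sub>F \<epsilon> in at_right 0. \<forall>j. finite_moments (transport \<iota> (F \<epsilon> j) x)"
      using tr by (rule eventually_all_finite)
    with scheme regular conservation
    have "\<forall>\<^sub>F \<epsilon> in at_right 0. moments (F \<epsilon> i x) = moments (fn x)
        - \<Delta>t *\<^sub>R (\<Sum>j | j < i. At $ i $ j *\<^sub>R moments (transport \<iota> (F \<epsilon> j) x))"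
    proof eventually_elim
      case (elim \<epsilon>)
      then show ?case
        using \<open>\<mu> > 0\<close> that by (intro imex_stage_moments[OF _ that initial[OF that] elim(1)]) auto
    qed
    then have "((\<lambda>\<epsilon>. moments (fn x) - \<Delta>t *\<^sub>R (\<Sum>j | j < i. At $ i $ j *\<^sub>R moments (transport \<iota> (F \<epsilon> j) x)))
        \<longlongrightarrow> moments (F0 i x)) (at_right 0)"
      by (rule Lim_transform_eventually[OF F_lim])
    moreover have "((\<lambda>\<epsilon>. moments (fn x) - \<Delta>t *\<^sub>R (\<Sum>j | j < i. At $ i $ j *\<^sub>R moments (transport \<iota> (F \<epsilon> j) x)))
        \<longlongrightarrow> moments (fn x) - \<Delta>t *\<^sub>R (\<Sum>j | j < i. At $ i $ j *\<^sub>R moments (transport \<iota> (F0 j) x))) (at_right 0)"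
      by (intro tendsto_intros tr_lim)
    ultimately show ?thesis
      using tendsto_unique[OF trivial_limit_at_right_real] euler(2)[OF that] by simp
  qed
  have "(\<Sum>j | j < ?N. At $ ?N $ j *\<^sub>R h j) = (\<Sum>j\<in>UNIV. wt $ j *\<^sub>R h j)" for h :: "'s \<Rightarrow> state"
    unfolding globally_stiffly_accurate using explicit
    by (intro sum.mono_neutral_left) (auto simp: not_less)
  then show "explicit_rk_euler \<iota> \<Omega> \<Delta>t At wt
       (\<lambda>x. moments (fn x)) (\<lambda>i x. moments (F0 i x)) (\<lambda>x. moments (F0 ?N x))"
    unfolding explicit_rk_euler_def using euler(1) stage stage[of _ ?N] by auto
qed

end
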